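(* Let $n\ge1$, $\varepsilon\in\{+,-\}^{n-1}$, and let $R=\{r_1<\cdots<r_s=n\}\subseteq[n]$, with $r_0=0$. The initial spectrum is concentrated at one position: $$h_1(k)=\begin{cases}a_1!\,b_1!,&k=a_1+1,\\0,&k\ne a_1+1.\end{cases}$$ For $2\le j\le s$ and $0\le d\le r_{j-1}$, define $$C_j(d)=\begin{cases}\sum_{t=1}^{d}h_{j-1}(t),&\varepsilon_{r_{j-1}}=-,\\[1mm]\sum_{t=d+1}^{r_{j-1}}h_{j-1}(t),&\varepsilon_{r_{j-1}}=+.\end{cases}$$ Then $$h_j(d+a_j+1)=a_j!\,b_j!\binom{d+a_j}{a_j}\binom{r_{j-1}-d+b_j}{b_j}C_j(d),$$ and all other entries of $h_j$ are zero. In particular, $$\ell_{\varepsilon,R}(k)=h_s(k)\quad(1\le k\le n),\qquad \#\{\pi\in S_n:\operatorname{Rec}_\varepsilon(\pi)=R\}=\sum_{k=1}^{n}h_s(k).$$ After factorials and binomial coefficients have been precomputed, the entire vector $(h_s(1),\ldots,h_s(n))$ is obtained in $O(n^2)$ arithmetic operations.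
   Context: Greedy records: for $\pi\in S_n$, set $i_0=n$; once $i_j$ is chosen, let $A_j(\pi)$ be the set of $i<i_j$ such that $\pi_i>\pi_{i_j}$ if $\varepsilon_i=+$, and $\pi_i<\pi_{i_j}$ if $\varepsilon_i=-$; stop if it is empty, otherwise $i_{j+1}=\max A_j(\pi)$. $\operatorname{Rec}_\varepsilon(\pi)=\{i_0,\ldots,i_s\}$. Record poset: for $i<n$ let $\rho_R(i)=\min\{r\in R:r>i\}$. $Q_{\varepsilon,R}$ is the poset on $[n]$ that is the transitive closure of the following relations, one for each $i<n$: $i<\rho_R(i)$ if ($\varepsilon_i=+$ and $i\notin R$) or ($\varepsilon_i=-$ and $i\in R$); otherwise $\rho_R(i)<i$. $\mathcal L(Q)$ denotes the set of linear extensions of $Q$, written as words $\sigma_1\sigma_2\cdots$ in which $a$ occurs before $b$ whenever $a<_Qb$. $\ell_{\varepsilon,R}(k)=\#\{\sigma\in\mathcal L(Q_{\varepsilon,R}):\sigma_k=n\}$. For $1\le j\le s$, $Q_j$ is the subposet of $Q_{\varepsilon,R}$ induced by $[r_j]$, the root spectrum is $h_j(k)=\#\{\sigma\in\mathcal L(Q_j):\sigma_k=r_j\}$ for $1\le k\le r_j$, and $a_j=\#\{i:r_{j-1}<i<r_j,\ \varepsilon_i=+\}$, $b_j=\#\{i:r_{j-1}<i<r_j,\ \varepsilon_i=-\}$. *)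

theory Defs
  imports Complex_Main "HOL-Combinatorics.Multiset_Permutations"
begin

section \<open>Greedy records\<close>

datatype sign = Pos | Neg

text \<open>
  A sign word of length \<open>n - 1\<close> is a function on \<open>nat\<close> of which only the values at
  \<open>1, \<dots>, n - 1\<close> are ever inspected. Permutations of \<open>{1..n}\<close> are functions with
  \<open>\<pi> permutes {1..n}\<close>.
\<close>

definition candidates :: "(nat \<Rightarrow> sign) \<Rightarrow> (nat \<Rightarrow> nat) \<Rightarrow> nat \<Rightarrow> nat set" where
  "candidates \<epsilon> \<pi> m =
     {i. 1 \<le> i \<and> i < m \<and> (case \<epsilon> i of Pos \<Rightarrow> \<pi> i > \<pi> m | Neg \<Rightarrow> \<pi> i < \<pi> m)}"

inductive_set Rec :: "nat \<Rightarrow> (nat \<Rightarrow> sign) \<Rightarrow> (nat \<Rightarrow> nat) \<Rightarrow> nat set"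
  for n :: nat and \<epsilon> :: "nat \<Rightarrow> sign" and \<pi> :: "nat \<Rightarrow> nat" where
  start: "n \<in> Rec n \<epsilon> \<pi>"
| step: "i \<in> Rec n \<epsilon> \<pi> \<Longrightarrow> candidates \<epsilon> \<pi> i \<noteq> {} \<Longrightarrow> Max (candidates \<epsilon> \<pi> i) \<in> Rec n \<epsilon> \<pi>"


section \<open>The record poset and its linear extensions\<close>

definition rho :: "nat set \<Rightarrow> nat \<Rightarrow> nat" where
  "rho R i = Min {r \<in> R. r > i}"

text \<open>Posets are given by their strict order, \<open>(a, b)\<close> meaning \<open>a < b\<close>.\<close>

definition record_gens :: "nat \<Rightarrow> (nat \<Rightarrow> sign) \<Rightarrow> nat set \<Rightarrow> (nat \<times> nat) set" where
  "record_gens n \<epsilon> R =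
     (\<lambda>i. if (\<epsilon> i = Pos \<and> i \<notin> R) \<or> (\<epsilon> i = Neg \<and> i \<in> R) then (i, rho R i) else (rho R i, i))
       ` {1..<n}"

definition record_poset :: "nat \<Rightarrow> (nat \<Rightarrow> sign) \<Rightarrow> nat set \<Rightarrow> (nat \<times> nat) set" where
  "record_poset n \<epsilon> R = (record_gens n \<epsilon> R)\<^sup>+"

text \<open>
  Words are lists, hence indexed from 0: the letter \<open>\<sigma>\<^sub>k\<close> is \<open>\<sigma> ! (k - 1)\<close>.
\<close>

definition linear_extensions :: "'a set \<Rightarrow> ('a \<times> 'a) set \<Rightarrow> 'a list set" where
  "linear_extensions X Q =
     {\<sigma> \<in> permutations_of_set X.
        \<forall>p < length \<sigma>. \<forall>q < length \<sigma>. (\<sigma> ! p, \<sigma> ! q) \<in> Q \<longrightarrow> p < q}"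

definition ell :: "nat \<Rightarrow> (nat \<Rightarrow> sign) \<Rightarrow> nat set \<Rightarrow> nat \<Rightarrow> nat" where
  "ell n \<epsilon> R k = card {\<sigma> \<in> linear_extensions {1..n} (record_poset n \<epsilon> R). \<sigma> ! (k - 1) = n}"


section \<open>Root spectra\<close>

text \<open>For \<open>R = {r\<^sub>1 < \<dots> < r\<^sub>s}\<close>, this is \<open>r\<^sub>j\<close>, with \<open>r\<^sub>0 = 0\<close>.\<close>

definition root_at :: "nat set \<Rightarrow> nat \<Rightarrow> nat" where
  "root_at R j = (if j = 0 then 0 else sorted_list_of_set R ! (j - 1))"

definition sub_poset :: "nat \<Rightarrow> (nat \<Rightarrow> sign) \<Rightarrow> nat set \<Rightarrow> nat \<Rightarrow> (nat \<times> nat) set" where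
  "sub_poset n \<epsilon> R j = Restr (record_poset n \<epsilon> R) {1..root_at R j}"

definition root_spectrum :: "nat \<Rightarrow> (nat \<Rightarrow> sign) \<Rightarrow> nat set \<Rightarrow> nat \<Rightarrow> nat \<Rightarrow> nat" where
  "root_spectrum n \<epsilon> R j k =
     card {\<sigma> \<in> linear_extensions {1..root_at R j} (sub_poset n \<epsilon> R j).
             \<sigma> ! (k - 1) = root_at R j}"

definition sign_count :: "sign \<Rightarrow> (nat \<Rightarrow> sign) \<Rightarrow> nat set \<Rightarrow> nat \<Rightarrow> nat" where
  "sign_count c \<epsilon> R j = card {i. root_at R (j - 1) < i \<and> i < root_at R j \<and> \<epsilon> i = c}"

abbreviation a_count :: "(nat \<Rightarrow> sign) \<Rightarrow> nat set \<Rightarrow> nat \<Rightarrow> nat" where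
  "a_count \<equiv> sign_count Pos"

abbreviation b_count :: "(nat \<Rightarrow> sign) \<Rightarrow> nat set \<Rightarrow> nat \<Rightarrow> nat" where
  "b_count \<equiv> sign_count Neg"

definition C_sum :: "nat \<Rightarrow> (nat \<Rightarrow> sign) \<Rightarrow> nat set \<Rightarrow> nat \<Rightarrow> nat \<Rightarrow> nat" where
  "C_sum n \<epsilon> R j d =
     (case \<epsilon> (root_at R (j - 1)) of
        Neg \<Rightarrow> \<Sum>t = 1..d. root_spectrum n \<epsilon> R (j - 1) t
      | Pos \<Rightarrow> \<Sum>t = d + 1..root_at R (j - 1). root_spectrum n \<epsilon> R (j - 1) t)"


section \<open>A cost model for arithmetic operations\<close>

text \<open>
  Complexity is measured by a small register language over the natural numbers. The memory
  consists of named arrays with two indices; \<open>Cell x (Const 0) (Const 0)\<close> serves as a scalar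
  variable. Subtraction on \<open>nat\<close> is truncated. In \<open>For x e c\<close> the bound \<open>e\<close> is evaluated
  once, and \<open>c\<close> is executed with the scalar \<open>x\<close> set to \<open>0, \<dots>, e - 1\<close> in turn.

  Every elementary step costs one unit: each constant, memory access, arithmetic operation,
  assignment, comparison and loop iteration. The number of steps therefore bounds the number
  of arithmetic operations, and arithmetic cannot be hidden in uncharged control flow.
\<close>

type_synonym memory = "string \<Rightarrow> nat \<Rightarrow> nat \<Rightarrow> nat"

datatype expr =
    Const nat
  | Cell string expr expr
  | Add expr expr
  | Sub expr expr
  | Mul expr expr

datatype prog =
    Assign string expr expr expr
  | Seq prog prog
  | IfLe expr expr prog prog
  | For string expr prog

primrec eval_expr :: "expr \<Rightarrow> memory \<Rightarrow> nat" where
  "eval_expr (Const c) M = c"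
| "eval_expr (Cell x e1 e2) M = M x (eval_expr e1 M) (eval_expr e2 M)"
| "eval_expr (Add e1 e2) M = eval_expr e1 M + eval_expr e2 M"
| "eval_expr (Sub e1 e2) M = eval_expr e1 M - eval_expr e2 M"
| "eval_expr (Mul e1 e2) M = eval_expr e1 M * eval_expr e2 M"

primrec expr_steps :: "expr \<Rightarrow> nat" where
  "expr_steps (Const c) = 1"
| "expr_steps (Cell x e1 e2) = 1 + expr_steps e1 + expr_steps e2"
| "expr_steps (Add e1 e2) = 1 + expr_steps e1 + expr_steps e2"
| "expr_steps (Sub e1 e2) = 1 + expr_steps e1 + expr_steps e2"
| "expr_steps (Mul e1 e2) = 1 + expr_steps e1 + expr_steps e2"

definition store :: "string \<Rightarrow> nat \<Rightarrow> nat \<Rightarrow> nat \<Rightarrow> memory \<Rightarrow> memory" where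
  "store x p q v M = M(x := (M x)(p := (M x p)(q := v)))"

text \<open>The result of \<open>run\<close> is the final memory together with the number of steps.\<close>

primrec run :: "prog \<Rightarrow> memory \<Rightarrow> memory \<times> nat" where
  "run (Assign x e1 e2 e) M =
     (store x (eval_expr e1 M) (eval_expr e2 M) (eval_expr e M) M,
      1 + expr_steps e1 + expr_steps e2 + expr_steps e)"
| "run (Seq c1 c2) M =
     (let (M1, t1) = run c1 M; (M2, t2) = run c2 M1 in (M2, t1 + t2))"
| "run (IfLe e1 e2 c1 c2) M =
     (let (M', t) = (if eval_expr e1 M \<le> eval_expr e2 M then run c1 M else run c2 M)
      in (M', 1 + expr_steps e1 + expr_steps e2 + t))"
| "run (For x e c) M =
     fold (\<lambda>i (M1, t1). let (M2, t2) = run c (store x 0 0 i M1) in (M2, t1 + 1 + t2))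
       [0..<eval_expr e M] (M, 1 + expr_steps e)"

text \<open>
  The input: \<open>n\<close>, the signs (coded as 1 for plus and 0 for minus), \<open>s\<close>, the increasing list
  \<open>r\<^sub>1, \<dots>, r\<^sub>s\<close>, and the precomputed factorials and binomial coefficients with arguments up
  to \<open>n\<close>. All other cells are initially 0.
\<close>

definition input_memory :: "nat \<Rightarrow> (nat \<Rightarrow> sign) \<Rightarrow> nat set \<Rightarrow> memory" where
  "input_memory n \<epsilon> R x p q =
     (if x = ''n'' \<and> p = 0 \<and> q = 0 then n
      else if x = ''eps'' \<and> 1 \<le> p \<and> p < n \<and> q = 0 then (if \<epsilon> p = Pos then 1 else 0)
      else if x = ''s'' \<and> p = 0 \<and> q = 0 then card R
      else if x = ''r'' \<and> 1 \<le> p \<and> p \<le> card R \<and> q = 0 then root_at R p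
      else if x = ''fact'' \<and> p \<le> n \<and> q = 0 then fact p
      else if x = ''binom'' \<and> p \<le> n \<and> q \<le> p then p choose q
      else 0)"

end

theory Submission
  imports Defs
begin

text \<open>
  The Hasse diagram of the record poset is a tree: every \<open>i < n\<close> has one edge, to the next
  element \<open>\<rho>\<^sub>R(i)\<close> of \<open>R\<close>. If \<open>m < z\<close> are consecutive in \<open>R \<union> {0}\<close>, then the edges inside \<open>[z]\<close>
  that do not lie inside \<open>[m]\<close> form a star with centre \<open>z\<close>, whose leaves are the letters strictly
  between \<open>m\<close> and \<open>z\<close> and, if \<open>m > 0\<close>, the letter \<open>m\<close>. A linear extension of \<open>[z]\<close> is therefore a
  word \<open>u z v\<close> in which all plus letters of the gap are in \<open>u\<close>, all minus letters are in \<open>v\<close>, the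
  sign of \<open>m\<close> says which side \<open>m\<close> is on, and deleting the letters above \<open>m\<close> leaves a linear
  extension \<open>l\<close> of \<open>[m]\<close> (\<open>extensions_gap\<close>). If \<open>d\<close> letters of \<open>l\<close> are in \<open>u\<close>, then \<open>u\<close> is a
  shuffle of the first \<open>d\<close> letters of \<open>l\<close> with an arrangement of the plus letters, \<open>v\<close> is a shuffle
  of the rest of \<open>l\<close> with an arrangement of the minus letters, and \<open>z\<close> is at position \<open>d + a + 1\<close>.
  Counting shuffles gives the factorials and binomials (\<open>card_words_split_at\<close>), and the words \<open>l\<close>
  with \<open>m\<close> on the correct side of the cut are counted by a partial sum of the spectrum of \<open>m\<close>. The first
  gap, \<open>m = 0\<close>, is the same statement with the empty word \<open>l\<close>.

  For the record count, \<open>Rec\<^sub>\<epsilon>(\<pi>) = R\<close> holds exactly if for each \<open>i < n\<close> the letter \<open>i\<close> is a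
  candidate at \<open>\<rho>\<^sub>R(i)\<close> precisely when it is in \<open>R\<close>. Read sign by sign, this says that \<open>\<pi>\<close> increases
  along every edge of the tree (\<open>Rec_eq_iff\<close>), so \<open>\<pi>\<inverse>\<close>, written as a word, is a linear extension.

  The quadratic algorithm stores each spectrum together with its prefix sums, so that each entry of
  the next one costs a bounded number of steps; a row takes \<open>O(n)\<close> steps and there are at most
  \<open>n\<close> rows. Setting row 0 of the prefix sums to \<open>1\<close> makes the first root an
  instance of the general step.
\<close>

section \<open>Linear extensions as words\<close>

lemma linear_extensions_Restr:
  "linear_extensions X (Restr Q X) = linear_extensions X Q"
  by (auto simp: linear_extensions_def dest: permutations_of_setD intro: nth_mem)

lemma linear_extensions_trancl:
  assumes "Q \<subseteq> X \<times> X"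
  shows "linear_extensions X (Q\<^sup>+) = linear_extensions X Q"
proof (intro equalityI subsetI)
  fix \<sigma> assume "\<sigma> \<in> linear_extensions X Q"
  then have \<sigma>: "set \<sigma> = X"
    and Q: "\<And>p q. p < length \<sigma> \<Longrightarrow> q < length \<sigma> \<Longrightarrow> (\<sigma> ! p, \<sigma> ! q) \<in> Q \<Longrightarrow> p < q"
    and perm: "\<sigma> \<in> permutations_of_set X"
    by (auto simp: linear_extensions_def dest: permutations_of_setD)
  have "p < q" if "(x, y) \<in> Q\<^sup>+" "p < length \<sigma>" "q < length \<sigma>" "\<sigma> ! p = x" "\<sigma> ! q = y" for x y p q
    using that
  proof (induction arbitrary: q rule: trancl_induct)
    case (base y)
    then show ?case using Q by blast
  next
    case (step y z)
    then obtain q' where "q' < length \<sigma>" "\<sigma> ! q' = y"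
      using \<sigma> assms by (metis SigmaD1 in_set_conv_nth subsetD)
    with step have "p < q'" "q' < q" using Q by blast+
    then show ?case by simp
  qed
  then show "\<sigma> \<in> linear_extensions X (Q\<^sup>+)"
    using perm by (auto simp: linear_extensions_def)
qed (auto simp: linear_extensions_def)

lemma linear_extensions_sorted_wrt:
  assumes "irrefl Q"
  shows "linear_extensions X Q = {\<sigma> \<in> permutations_of_set X. sorted_wrt (\<lambda>x y. (y, x) \<notin> Q) \<sigma>}"
proof -
  have "(\<forall>p < length \<sigma>. \<forall>q < length \<sigma>. (\<sigma> ! p, \<sigma> ! q) \<in> Q \<longrightarrow> p < q)
      \<longleftrightarrow> sorted_wrt (\<lambda>x y. (y, x) \<notin> Q) \<sigma>" for \<sigma>
    using assms unfolding sorted_wrt_iff_nth_less irrefl_def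
    by (metis linorder_neqE_nat order.asym order.strict_trans)
  then show ?thesis by (simp add: linear_extensions_def)
qed

text \<open>
  A chain of relations that leaves a set closed under successors never returns, and dually for
  predecessors; hence a chain between two elements of \<open>A\<close> stays in \<open>A\<close>. Without closure, the
  relation induced on \<open>A\<close> by the transitive closure may be larger.
\<close>

lemma Restr_trancl_closed:
  assumes "Q `` A \<subseteq> A \<or> Q\<inverse> `` A \<subseteq> A"
  shows "Restr (Q\<^sup>+) A = (Restr Q A)\<^sup>+"
proof
  have up: "x \<in> A \<longrightarrow> y \<in> A \<and> (x, y) \<in> (Restr Q A)\<^sup>+"
    if "(x, y) \<in> Q\<^sup>+" "Q `` A \<subseteq> A" for x y Q
    using that by (induction rule: trancl_induct) (auto intro: trancl_into_trancl)
  show "Restr (Q\<^sup>+) A \<subseteq> (Restr Q A)\<^sup>+"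
    using assms
  proof
    assume "Q\<inverse> `` A \<subseteq> A"
    moreover have "Restr (Q\<inverse>) A = (Restr Q A)\<inverse>" by auto
    ultimately show ?thesis using up[of _ _ "Q\<inverse>"] by (auto simp: trancl_converse)
  qed (use up in auto)
  show "(Restr Q A)\<^sup>+ \<subseteq> Restr (Q\<^sup>+) A"
    by (auto dest: trancl_mono[OF _ Int_lower1] tranclD tranclD2)
qed

text \<open>
  Constraints that concern only pairs of letters from \<open>A\<close> can be tested after the other letters
  have been deleted.
\<close>

lemma sorted_wrt_filter_iff:
  assumes "\<And>x y. \<not> (x \<in> A \<and> y \<in> A) \<Longrightarrow> P x y"
  shows "sorted_wrt P w \<longleftrightarrow> sorted_wrt P (filter (\<lambda>x. x \<in> A) w)"
  using assms by (induction w) auto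

section \<open>Words cut at a letter\<close>

text \<open>
  Such a word \<open>u\<close> is a shuffle of \<open>l\<close> with an arrangement of \<open>X\<close>. The predicate \<open>P\<close> need only
  separate \<open>l\<close> from \<open>X\<close>, so that the lemma applies to a segment of a longer word and the letter
  test for that longer word.
\<close>

lemma card_shuffled_words:
  assumes "finite X" "distinct l" and P: "\<And>x. x \<in> set l \<Longrightarrow> P x" "\<And>x. x \<in> X \<Longrightarrow> \<not> P x"
  shows "card {u \<in> permutations_of_set (set l \<union> X). filter P u = l}
       = fact (card X) * ((length l + card X) choose card X)"
proof -
  have disj: "set l \<inter> X = {}" using P by blast
  have filt: "filter P u = l" "filter (\<lambda>x. \<not> P x) u = p"
    if u: "u \<in> shuffles l p" and p: "p \<in> permutations_of_set X" for u p
  proof -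
    have id: "filter P l = l" "filter P p = []"
        "filter (\<lambda>x. \<not> P x) l = []" "filter (\<lambda>x. \<not> P x) p = p"
      using P permutations_of_setD[OF p] by (auto simp: filter_id_conv filter_empty_conv)
    have "filter P u \<in> shuffles (filter P l) (filter P p)"
      using imageI[OF u, of "filter P"] by (simp only: filter_shuffles)
    then show "filter P u = l" using id by simp
    have "filter (\<lambda>x. \<not> P x) u \<in> shuffles (filter (\<lambda>x. \<not> P x) l) (filter (\<lambda>x. \<not> P x) p)"
      using imageI[OF u, of "filter (\<lambda>x. \<not> P x)"] by (simp only: filter_shuffles)
    then show "filter (\<lambda>x. \<not> P x) u = p" using id by simp
  qed
  have eq: "{u \<in> permutations_of_set (set l \<union> X). filter P u = l}
      = (\<Union>p \<in> permutations_of_set X. shuffles l p)"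
  proof (intro equalityI subsetI)
    fix u assume u: "u \<in> {u \<in> permutations_of_set (set l \<union> X). filter P u = l}"
    then have "filter (\<lambda>x. \<not> P x) u \<in> permutations_of_set X"
      using P by (auto simp: permutations_of_set_def)
    moreover have "u \<in> shuffles l (filter (\<lambda>x. \<not> P x) u)"
      using partition_in_shuffles[of u P] u by simp
    ultimately show "u \<in> (\<Union>p \<in> permutations_of_set X. shuffles l p)" by blast
  next
    fix u assume "u \<in> (\<Union>p \<in> permutations_of_set X. shuffles l p)"
    then obtain p where p: "set p = X" "distinct p" and u: "u \<in> shuffles l p"
      by (auto dest: permutations_of_setD)
    have "filter P u = l" using filt(1)[OF u] p by (simp add: permutations_of_set_def)
    moreover have "u \<in> permutations_of_set (set l \<union> X)"
      using set_shuffles[OF u] distinct_disjoint_shuffles[OF assms(2) p(2) _ u] p disj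
      by (simp add: permutations_of_set_def)
    ultimately show "u \<in> {u \<in> permutations_of_set (set l \<union> X). filter P u = l}" by simp
  qed
  have "card (\<Union>p \<in> permutations_of_set X. shuffles l p) = (\<Sum>p \<in> permutations_of_set X. card (shuffles l p))"
  proof (rule card_UN_disjoint)
    show "\<forall>p \<in> permutations_of_set X. \<forall>p' \<in> permutations_of_set X. p \<noteq> p' \<longrightarrow>
        shuffles l p \<inter> shuffles l p' = {}"
      using filt(2) by blast
  qed auto
  also have "\<dots> = (\<Sum>p \<in> permutations_of_set X. (length l + card X) choose card X)"
  proof (rule sum.cong[OF refl])
    fix p assume p: "p \<in> permutations_of_set X"
    then have "length p = card X" "set p = X"
      by (auto dest: permutations_of_setD simp: length_finite_permutations_of_set)
    then show "card (shuffles l p) = (length l + card X) choose card X"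
      using disj card_disjoint_shuffles[of l p]
      by (simp add: binomial_symmetric[of "card X" "length l + card X"])
  qed
  finally show ?thesis using assms eq by simp
qed

text \<open>
  Since \<open>u\<close> contains \<open>X\<close> and nothing of \<open>Y\<close>, its length determines how many letters of \<open>A\<close> it
  contains; so the cut of \<open>w\<close> at \<open>z\<close> cuts the restriction to \<open>A\<close> after \<open>d\<close> letters.
\<close>

lemma filter_split_at:
  assumes w: "w = u @ z # v" and dw: "distinct w" and set_w: "set w = insert z (A \<union> X \<union> Y)"
    and len: "length u = d + card X" and X: "X \<subseteq> set u" and Y: "Y \<subseteq> set v"
    and fin: "finite X" and disj: "A \<inter> X = {}" "A \<inter> Y = {}" and z: "z \<notin> A \<union> X \<union> Y"
  shows "take d (filter (\<lambda>x. x \<in> A) w) = filter (\<lambda>x. x \<in> A) u"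
    and "drop d (filter (\<lambda>x. x \<in> A) w) = filter (\<lambda>x. x \<in> A) v"
    and "set u = set (filter (\<lambda>x. x \<in> A) u) \<union> X"
    and "set v = set (filter (\<lambda>x. x \<in> A) v) \<union> Y"
proof -
  let ?f = "filter (\<lambda>x. x \<in> A)"
  have fw: "?f w = ?f u @ ?f v" using w z by simp
  show su: "set u = set (?f u) \<union> X"
    using w X Y dw set_w z by auto
  show "set v = set (?f v) \<union> Y"
    using w X Y dw set_w z by auto
  have "d + card X = card (set u)" using len dw w by (simp add: distinct_card)
  also have "\<dots> = card (set (?f u)) + card X"
    by (subst su, rule card_Un_disjoint) (use fin disj in auto)
  finally have "length (?f u) = d" using dw w distinct_card[of "?f u"] by simp
  then show "take d (?f w) = ?f u" "drop d (?f w) = ?f v" by (simp_all add: fw)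
qed

text \<open>
  Given the restriction \<open>l\<close> of \<open>w\<close> to \<open>A\<close>, the prefix \<open>u\<close> and the suffix \<open>v\<close> range independently
  over shuffles of \<open>take d l\<close> with \<open>X\<close> and of \<open>drop d l\<close> with \<open>Y\<close>.
\<close>

lemma card_words_split_at:
  assumes fin: "finite A" "finite X" "finite Y"
    and disj: "A \<inter> X = {}" "A \<inter> Y = {}" "X \<inter> Y = {}" and z: "z \<notin> A \<union> X \<union> Y"
    and L: "L \<subseteq> permutations_of_set A" and d: "d \<le> card A"
  shows "card {w \<in> permutations_of_set (insert z (A \<union> X \<union> Y)).
            \<exists>u v. w = u @ z # v \<and> length u = d + card X \<and> X \<subseteq> set u \<and> Y \<subseteq> set v \<and>
                  filter (\<lambda>x. x \<in> A) w \<in> L}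
       = fact (card X) * fact (card Y) * ((d + card X) choose card X)
           * ((card A - d + card Y) choose card Y) * card L"
    (is "card ?W = _")
proof -
  let ?f = "filter (\<lambda>x. x \<in> A)"
  define U where "U l = {u \<in> permutations_of_set (set (take d l) \<union> X). ?f u = take d l}" for l
  define V where "V l = {v \<in> permutations_of_set (set (drop d l) \<union> Y). ?f v = drop d l}" for l
  have l: "distinct l" "set l = A" "length l = card A" if "l \<in> L" for l
    using that L fin by (auto dest: permutations_of_setD simp: length_finite_permutations_of_set subset_iff)
  have lU: "length u = d + card X" if "u \<in> U l" "l \<in> L" for u l
  proof -
    have "length u = card (set (take d l) \<union> X)"
      using that by (auto simp: U_def length_finite_permutations_of_set)
    also have "\<dots> = card (set (take d l)) + card X"
      using l[OF that(2)] disj fin by (intro card_Un_disjoint) (auto dest: in_set_takeD)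
    also have "card (set (take d l)) = d"
      using l[OF that(2)] d by (simp add: distinct_card)
    finally show ?thesis .
  qed
  have flt: "?f (u @ z # v) = l" if "u \<in> U l" "v \<in> V l" for u v l
    using that z by (auto simp: U_def V_def)
  have W: "?W = (\<Union>l \<in> L. (\<lambda>(u, v). u @ z # v) ` (U l \<times> V l))"
  proof (intro equalityI subsetI)
    fix w assume "w \<in> ?W"
    then obtain u v where w: "w = u @ z # v" and lu: "length u = d + card X"
      and X: "X \<subseteq> set u" and Y: "Y \<subseteq> set v" and fw: "?f w \<in> L"
      and set_w: "set w = insert z (A \<union> X \<union> Y)" and dw: "distinct w"
      unfolding permutations_of_set_def by blast
    note split = filter_split_at[OF w dw set_w lu X Y fin(2) disj(1,2) z]
    have "distinct u" "distinct v" using dw w by auto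
    then have "u \<in> U (?f w)" "v \<in> V (?f w)"
      unfolding U_def V_def permutations_of_set_def split(1,2) using split(3,4) by blast+
    then show "w \<in> (\<Union>l \<in> L. (\<lambda>(u, v). u @ z # v) ` (U l \<times> V l))"
      by (intro UN_I[OF fw] image_eqI[of _ _ "(u, v)"]) (simp_all add: w)
  next
    fix w assume "w \<in> (\<Union>l \<in> L. (\<lambda>(u, v). u @ z # v) ` (U l \<times> V l))"
    then obtain l u v where lL: "l \<in> L" and u: "u \<in> U l" and v: "v \<in> V l" and w: "w = u @ z # v"
      by auto
    have su: "set u = set (take d l) \<union> X" "distinct u" and sv: "set v = set (drop d l) \<union> Y" "distinct v"
      using u v unfolding U_def V_def permutations_of_set_def by blast+
    have tl: "set (take d l) \<union> set (drop d l) = A"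
      by (simp flip: l(2)[OF lL] set_append)
    have tl': "set (take d l) \<inter> set (drop d l) = {}"
      using l(1)[OF lL] by (simp add: set_take_disj_set_drop_if_distinct)
    have "set w = insert z (A \<union> X \<union> Y)"
      unfolding w set_append list.set su sv tl[symmetric] by blast
    moreover have "distinct w"
      unfolding w distinct_append distinct.simps list.set su(1) sv(1)
      using su(2) sv(2) tl tl' z disj by blast
    ultimately have "w \<in> permutations_of_set (insert z (A \<union> X \<union> Y))"
      by (rule permutations_of_setI)
    moreover have "?f w \<in> L" unfolding w flt[OF u v] by (rule lL)
    moreover have "X \<subseteq> set u" "Y \<subseteq> set v" unfolding su sv by simp_all
    ultimately show "w \<in> ?W" using w lU[OF u lL] by (simp only: mem_Collect_eq) metis
  qed
  have "card ?W = (\<Sum>l \<in> L. card ((\<lambda>(u, v). u @ z # v) ` (U l \<times> V l)))"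
    unfolding W
  proof (rule card_UN_disjoint)
    show "finite L" by (rule finite_subset[OF L]) simp
    show "\<forall>l \<in> L. finite ((\<lambda>(u, v). u @ z # v) ` (U l \<times> V l))"
      by (auto simp: U_def V_def)
    have "?f w = l" if "w \<in> (\<lambda>(u, v). u @ z # v) ` (U l \<times> V l)" for w l
      using that flt by (elim imageE SigmaE) simp
    then show "\<forall>l \<in> L. \<forall>l' \<in> L. l \<noteq> l' \<longrightarrow>
        (\<lambda>(u, v). u @ z # v) ` (U l \<times> V l) \<inter> (\<lambda>(u, v). u @ z # v) ` (U l' \<times> V l') = {}"
      by (metis disjoint_iff)
  qed
  also have "\<dots> = (\<Sum>l \<in> L. fact (card X) * ((d + card X) choose card X)
      * (fact (card Y) * ((card A - d + card Y) choose card Y)))"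
  proof (rule sum.cong[OF refl])
    fix l' assume lL: "l' \<in> L"
    note l = l[OF lL]
    have "card ((\<lambda>(u, v). u @ z # v) ` (U l' \<times> V l')) = card (U l' \<times> V l')"
      using lU[OF _ lL] by (intro card_image) (simp add: inj_on_def)
    also have "\<dots> = card (U l') * card (V l')" by (rule card_cartesian_product)
    also have "card (U l') = fact (card X) * ((d + card X) choose card X)"
      unfolding U_def using card_shuffled_words[of X "take d l'" "\<lambda>x. x \<in> A"] l fin disj d
      by (auto dest: in_set_takeD)
    also have "card (V l') = fact (card Y) * ((card A - d + card Y) choose card Y)"
      unfolding V_def using card_shuffled_words[of Y "drop d l'" "\<lambda>x. x \<in> A"] l fin disj d
      by (auto dest: in_set_dropD)
    finally show "card ((\<lambda>(u, v). u @ z # v) ` (U l' \<times> V l'))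
        = fact (card X) * ((d + card X) choose card X)
          * (fact (card Y) * ((card A - d + card Y) choose card Y))" .
  qed
  finally show ?thesis by simp
qed

section \<open>The record poset\<close>

locale record_set =
  fixes n :: nat and \<epsilon> :: "nat \<Rightarrow> sign" and R :: "nat set"
  assumes R_subset: "R \<subseteq> {1..n}" and n_in_R: "n \<in> R"
begin

abbreviation gens :: "(nat \<times> nat) set" where "gens \<equiv> record_gens n \<epsilon> R"

text \<open>
  The edge at \<open>i\<close> is \<open>i < \<rho>\<^sub>R(i)\<close> if \<open>points_up i\<close>, and \<open>\<rho>\<^sub>R(i) < i\<close> otherwise.
\<close>

definition points_up :: "nat \<Rightarrow> bool" where
  "points_up i \<longleftrightarrow> (\<epsilon> i = Pos \<and> i \<notin> R) \<or> (\<epsilon> i = Neg \<and> i \<in> R)"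

text \<open>
  Only letters of \<open>[z]\<close> occur in these words, so the generators outside \<open>[z]\<close> impose nothing.
\<close>

definition extensions :: "nat \<Rightarrow> nat list set" where
  "extensions z = linear_extensions {1..z} gens"

text \<open>
  The root spectrum, indexed by the root itself instead of its number in \<open>R\<close>.
\<close>

definition spectrum :: "nat \<Rightarrow> nat \<Rightarrow> nat" where
  "spectrum z k = card {w \<in> extensions z. w ! (k - 1) = z}"

text \<open>
  The value \<open>m = 0\<close> is the convention \<open>r\<^sub>0 = 0\<close>, which treats the letters below the first root
  as a gap like the others.
\<close>

definition consecutive :: "nat \<Rightarrow> nat \<Rightarrow> bool" where
  "consecutive m z \<longleftrightarrow> (m = 0 \<or> m \<in> R) \<and> z \<in> R \<and> m < z \<and> (\<forall>x \<in> R. \<not> (m < x \<and> x < z))"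

lemma finite_R: "finite R"
  using R_subset finite_subset by blast

lemma n_pos: "n \<ge> 1"
  using R_subset n_in_R by auto

lemma rho:
  assumes "i < n"
  shows "rho R i \<in> R" "i < rho R i" "\<And>x. x \<in> R \<Longrightarrow> i < x \<Longrightarrow> rho R i \<le> x"
proof -
  have fin: "finite {r \<in> R. r > i}" and ne: "{r \<in> R. r > i} \<noteq> {}"
    using finite_R n_in_R assms by auto
  show "rho R i \<in> R" "i < rho R i" using Min_in[OF fin ne] by (auto simp: rho_def)
  show "rho R i \<le> x" if "x \<in> R" "i < x" for x
    using that fin by (simp add: rho_def)
qed

lemma gens_iff:
  "(x, y) \<in> gens \<longleftrightarrow> (1 \<le> x \<and> x < n \<and> points_up x \<and> y = rho R x)
                 \<or> (1 \<le> y \<and> y < n \<and> \<not> points_up y \<and> x = rho R y)"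
  by (auto simp: record_gens_def points_up_def image_iff)

lemma gens_subset: "gens \<subseteq> {1..n} \<times> {1..n}"
  using rho R_subset by (auto simp: gens_iff) (meson atLeastAtMost_iff subsetD)+

lemma irrefl_gens: "irrefl gens"
  using rho by (fastforce simp: irrefl_def gens_iff)

lemma extensions_sorted_wrt: "extensions z = {w \<in> permutations_of_set {1..z}. sorted_wrt (\<lambda>x y. (y, x) \<notin> gens) w}"
  unfolding extensions_def by (rule linear_extensions_sorted_wrt[OF irrefl_gens])

text \<open>
  The only edge of the tree that can leave \<open>[z]\<close> is the one at \<open>z\<close>. According to its direction,
  \<open>[z]\<close> is closed under predecessors or under successors, so the poset induced on \<open>[z]\<close> is generated
  by the edges inside \<open>[z]\<close>, and its linear extensions can be tested on these edges alone.
\<close>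

lemma linear_extensions_record_poset:
  assumes "z \<in> R"
  shows "linear_extensions {1..z} (Restr (record_poset n \<epsilon> R) {1..z}) = extensions z"
proof -
  have le: "rho R i \<le> z" if "i < z" "i < n" for i
    using rho(3)[OF that(2) assms that(1)] .
  have zn: "z \<le> n" using assms R_subset by auto
  have gt: "i < rho R i" if "i < n" for i using rho(2)[OF that] .
  have "gens `` {1..z} \<subseteq> {1..z} \<or> gens\<inverse> `` {1..z} \<subseteq> {1..z}"
  proof (cases "z = n")
    case True
    then show ?thesis using gens_subset by blast
  next
    case False
    show ?thesis
    proof (cases "points_up z")
      case True
      have "x \<in> {1..z}" if "(x, y) \<in> gens" "y \<in> {1..z}" for x y
        using that gens_subset le[of y] gt[of x] gt[of y] True
        by (cases "y = z") (auto simp: gens_iff)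
      then show ?thesis by blast
    next
      case False
      have "y \<in> {1..z}" if "(x, y) \<in> gens" "x \<in> {1..z}" for x y
        using that gens_subset le[of x] gt[of y] gt[of x] False
        by (cases "x = z") (auto simp: gens_iff)
      then show ?thesis by blast
    qed
  qed
  then have "Restr (record_poset n \<epsilon> R) {1..z} = (Restr gens {1..z})\<^sup>+"
    unfolding record_poset_def by (rule Restr_trancl_closed)
  then show ?thesis
    by (simp add: extensions_def linear_extensions_trancl linear_extensions_Restr)
qed

text \<open>
  The letter \<open>z\<close> occurs at one position only, so summing spectrum entries counts words by
  the position of their root.
\<close>

lemma sum_spectrum:
  assumes "T \<subseteq> {1..z}"
  shows "(\<Sum>t \<in> T. spectrum z t) = card {w \<in> extensions z. \<exists>t \<in> T. w ! (t - 1) = z}"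
proof -
  have "card (\<Union>t \<in> T. {w \<in> extensions z. w ! (t - 1) = z}) = (\<Sum>t \<in> T. card {w \<in> extensions z. w ! (t - 1) = z})"
  proof (rule card_UN_disjoint)
    show "finite T" using assms finite_subset by blast
    show "\<forall>t \<in> T. finite {w \<in> extensions z. w ! (t - 1) = z}"
      by (simp add: extensions_sorted_wrt)
    have "t = t'" if "w \<in> extensions z" "w ! (t - 1) = z" "w ! (t' - 1) = z" "t \<in> T" "t' \<in> T" for w t t'
    proof -
      have "distinct w" "length w = z"
        using that(1) by (auto simp: extensions_sorted_wrt permutations_of_set_def dest: distinct_card)
      moreover have "1 \<le> t" "t \<le> z" "1 \<le> t'" "t' \<le> z" using that assms by auto
      ultimately have "t - 1 = t' - 1"
        using that(2,3) by (simp flip: nth_eq_iff_index_eq)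
      then show ?thesis using \<open>1 \<le> t\<close> \<open>1 \<le> t'\<close> by simp
    qed
    then show "\<forall>t \<in> T. \<forall>t' \<in> T. t \<noteq> t' \<longrightarrow>
        {w \<in> extensions z. w ! (t - 1) = z} \<inter> {w \<in> extensions z. w ! (t' - 1) = z} = {}"
      by blast
  qed
  moreover have "(\<Union>t \<in> T. {w \<in> extensions z. w ! (t - 1) = z}) = {w \<in> extensions z. \<exists>t \<in> T. w ! (t - 1) = z}"
    by blast
  ultimately show ?thesis by (simp add: spectrum_def)
qed

lemma extensions_word: "w \<in> extensions z \<Longrightarrow> length w = z" "w \<in> extensions z \<Longrightarrow> distinct w" "w \<in> extensions z \<Longrightarrow> set w = {1..z}"
  by (auto simp: extensions_sorted_wrt permutations_of_set_def dest: distinct_card)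

lemma card_extensions: 
  assumes "1 \<le> z"
  shows "card (extensions z) = (\<Sum>t = 1..z. spectrum z t)"
proof -
  have "\<exists>t \<in> {1..z}. w ! (t - 1) = z" if wL: "w \<in> extensions z" for w
  proof -
    have "z \<in> set w" using extensions_word(3)[OF wL] assms by auto
    then obtain i where "i < z" "w ! i = z"
      using extensions_word(1)[OF wL] by (auto simp: in_set_conv_nth)
    then show ?thesis by (intro bexI[of _ "Suc i"]) auto
  qed
  then have "{w \<in> extensions z. \<exists>t \<in> {1..z}. w ! (t - 1) = z} = extensions z" by blast
  then show ?thesis using sum_spectrum[of "{1..z}" z] by simp
qed

lemma card_root_in_take:
  assumes "d \<le> z"
  shows "card {w \<in> extensions z. z \<in> set (take d w)} = (\<Sum>t = 1..d. spectrum z t)"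
proof -
  have "z \<in> set (take d w) \<longleftrightarrow> (\<exists>t \<in> {1..d}. w ! (t - 1) = z)" if "w \<in> extensions z" for w
  proof
    assume "z \<in> set (take d w)"
    then obtain i where "i < d" "w ! i = z" by (auto simp: in_set_conv_nth)
    then show "\<exists>t \<in> {1..d}. w ! (t - 1) = z" by (intro bexI[of _ "Suc i"]) auto
  next
    assume "\<exists>t \<in> {1..d}. w ! (t - 1) = z"
    then obtain t where t: "1 \<le> t" "t \<le> d" "w ! (t - 1) = z" by auto
    moreover have "t - 1 < length w" using t assms extensions_word(1)[OF that] by simp
    ultimately show "z \<in> set (take d w)"
      by (auto simp: in_set_conv_nth intro!: exI[of _ "t - 1"])
  qed
  then have "{w \<in> extensions z. z \<in> set (take d w)} = {w \<in> extensions z. \<exists>t \<in> {1..d}. w ! (t - 1) = z}"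
    by blast
  then show ?thesis using sum_spectrum[of "{1..d}" z] assms by simp
qed

lemma card_root_in_drop:
  assumes "d \<le> z"
  shows "card {w \<in> extensions z. z \<in> set (drop d w)} = (\<Sum>t = d + 1..z. spectrum z t)"
proof -
  have "z \<in> set (drop d w) \<longleftrightarrow> (\<exists>t \<in> {d + 1..z}. w ! (t - 1) = z)" if wL: "w \<in> extensions z" for w
  proof
    assume "z \<in> set (drop d w)"
    then obtain i where "i < z - d" "w ! (d + i) = z"
      using extensions_word(1)[OF wL] assms by (auto simp: in_set_conv_nth)
    then show "\<exists>t \<in> {d + 1..z}. w ! (t - 1) = z" by (intro bexI[of _ "Suc (d + i)"]) auto
  next
    assume "\<exists>t \<in> {d + 1..z}. w ! (t - 1) = z"
    then obtain t where t: "d + 1 \<le> t" "t \<le> z" "w ! (t - 1) = z" by auto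
    then show "z \<in> set (drop d w)"
      using extensions_word(1)[OF wL] assms
      by (auto simp: in_set_conv_nth intro!: exI[of _ "t - 1 - d"])
  qed
  then have "{w \<in> extensions z. z \<in> set (drop d w)} = {w \<in> extensions z. \<exists>t \<in> {d + 1..z}. w ! (t - 1) = z}"
    by blast
  then show ?thesis using sum_spectrum[of "{d + 1..z}" z] by simp
qed

end

section \<open>From one root to the next\<close>

locale record_gap = record_set +
  fixes m z :: nat
  assumes gap: "consecutive m z"
begin

definition plus_block where "plus_block = {i. m < i \<and> i < z \<and> \<epsilon> i = Pos}"
definition minus_block where "minus_block = {i. m < i \<and> i < z \<and> \<epsilon> i = Neg}"

lemma gap_bounds: "m < z" "z \<in> R" "z \<le> n" "m \<noteq> 0 \<Longrightarrow> m \<in> R"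
  using gap R_subset by (auto simp: consecutive_def)

lemma gap_partition: "finite plus_block" "finite minus_block" "{1..m} \<inter> plus_block = {}" "{1..m} \<inter> minus_block = {}" "plus_block \<inter> minus_block = {}"
  "z \<notin> {1..m} \<union> plus_block \<union> minus_block" "insert z ({1..m} \<union> plus_block \<union> minus_block) = {1..z}"
  using gap_bounds(1) by (auto simp: plus_block_def minus_block_def) (metis sign.exhaust)+

lemma gap_sizes: "m + card plus_block + card minus_block + 1 = z"
proof -
  have "card {1..z} = Suc (card ({1..m} \<union> plus_block \<union> minus_block))"
    using gap_partition by (metis card_insert_disjoint finite_Un finite_atLeastAtMost)
  also have "card ({1..m} \<union> plus_block \<union> minus_block) = card ({1..m} \<union> plus_block) + card minus_block"
    using gap_partition by (intro card_Un_disjoint) auto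
  also have "card ({1..m} \<union> plus_block) = card {1..m} + card plus_block"
    using gap_partition by (intro card_Un_disjoint) auto
  finally show ?thesis by simp
qed

lemma rho_eq: "m \<le> i \<Longrightarrow> i < z \<Longrightarrow> rho R i = z"
  using rho[of i] gap_bounds gap by (force simp: consecutive_def intro: antisym)

lemma rho_le: "1 \<le> i \<Longrightarrow> i < m \<Longrightarrow> rho R i \<le> m"
  using rho[of i] gap_bounds by auto

text \<open>
  The leaves of the star with centre \<open>z\<close>. They include \<open>m\<close>, if positive, which the
  gap itself does not.
\<close>

definition above_z where "above_z = {i. 1 \<le> i \<and> m \<le> i \<and> i < z \<and> \<not> points_up i}"
definition below_z where "below_z = {i. 1 \<le> i \<and> m \<le> i \<and> i < z \<and> points_up i}"

lemma gens_gap: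
  assumes "x \<in> {1..z}" "y \<in> {1..z}"
  shows "(x, y) \<in> gens \<longleftrightarrow> (x \<le> m \<and> y \<le> m \<and> (x, y) \<in> gens)
      \<or> (x \<in> below_z \<and> y = z) \<or> (x = z \<and> y \<in> above_z)"
proof -
  have *: "i < m \<and> rho R i \<le> m \<or> m \<le> i \<and> i < z \<and> rho R i = z" if "1 \<le> i" "i < n" "rho R i \<le> z" for i
    using that rho_le[of i] rho_eq[of i] rho(2)[of i] by linarith
  show ?thesis
  proof
    assume "(x, y) \<in> gens"
    with assms *[of x] *[of y] show "(x \<le> m \<and> y \<le> m \<and> (x, y) \<in> gens)
      \<or> (x \<in> below_z \<and> y = z) \<or> (x = z \<and> y \<in> above_z)"
      by (auto simp: gens_iff below_z_def above_z_def)
  next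
    assume "(x \<le> m \<and> y \<le> m \<and> (x, y) \<in> gens)
      \<or> (x \<in> below_z \<and> y = z) \<or> (x = z \<and> y \<in> above_z)"
    then show "(x, y) \<in> gens"
      using rho_eq[of x] rho_eq[of y] gap_bounds
      by (auto simp: gens_iff below_z_def above_z_def)
  qed
qed

lemma gens_roots:
  "x \<in> below_z \<Longrightarrow> (x, z) \<in> gens \<and> x \<in> {1..z} \<and> x \<noteq> z"
  "x \<in> above_z \<Longrightarrow> (z, x) \<in> gens \<and> x \<in> {1..z} \<and> x \<noteq> z"
  using rho_eq[of x] gap_bounds(3) by (auto simp: gens_iff below_z_def above_z_def)

text \<open>
  The edges inside \<open>[z]\<close> are those inside \<open>[m]\<close>, which are tested on the restriction of the word
  to \<open>[m]\<close>, and those of the star, which only ask on which side of \<open>z\<close> each leaf is.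
\<close>

lemma extensions_gap:
  "w \<in> extensions z \<longleftrightarrow> w \<in> permutations_of_set {1..z} \<and> filter (\<lambda>x. x \<in> {1..m}) w \<in> extensions m
      \<and> (\<exists>u v. w = u @ z # v \<and> below_z \<subseteq> set u \<and> above_z \<subseteq> set v)"
    (is "_ \<longleftrightarrow> ?P w \<and> ?F w \<and> ?S w")
proof (intro iffI conjI)
  assume w: "w \<in> extensions z"
  then have sw: "sorted_wrt (\<lambda>x y. (y, x) \<notin> gens) w" and set_w: "set w = {1..z}" and dw: "distinct w"
    and pw: "?P w"
    by (auto simp: extensions_sorted_wrt permutations_of_set_def)
  show "?P w" by (rule pw)
  have "set (filter (\<lambda>x. x \<in> {1..m}) w) = {1..m}" using set_w gap_bounds(1) by auto
  then show "?F w"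
    using sw dw by (simp add: extensions_sorted_wrt permutations_of_set_def sorted_wrt_filter)
  have "z \<in> set w" using set_w gap_bounds(1) by simp
  then obtain u v where uv: "w = u @ z # v" by (meson split_list)
  have not_v: "\<forall>x \<in> set v. (x, z) \<notin> gens" and not_u: "\<forall>x \<in> set u. (z, x) \<notin> gens"
    using sw unfolding uv sorted_wrt_append by simp_all
  have set_uv: "set w = insert z (set u \<union> set v)" unfolding uv by simp
  have "x \<in> set u" if "x \<in> below_z" for x
  proof -
    have x: "x \<in> {1..z}" "x \<noteq> z" "(x, z) \<in> gens"
      using gens_roots(1)[OF that] by auto
    then show ?thesis using not_v set_w set_uv by blast
  qed
  moreover have "x \<in> set v" if "x \<in> above_z" for x
  proof -
    have x: "x \<in> {1..z}" "x \<noteq> z" "(z, x) \<in> gens"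
      using gens_roots(2)[OF that] by auto
    then show ?thesis using not_u set_w set_uv by blast
  qed
  ultimately show "?S w" using uv by blast
next
  assume "?P w \<and> ?F w \<and> ?S w"
  then obtain u v where pw: "?P w" and F: "?F w" and uv: "w = u @ z # v"
    and u: "below_z \<subseteq> set u" and v: "above_z \<subseteq> set v" by blast
  let ?old = "\<lambda>x y. \<not> (x \<in> {1..m} \<and> y \<in> {1..m} \<and> (y, x) \<in> gens)"
  let ?new = "\<lambda>x y. \<not> (y \<in> below_z \<and> x = z \<or> y = z \<and> x \<in> above_z)"
  have dw: "distinct w" and set_w: "set w = {1..z}"
    using pw by (auto simp: permutations_of_set_def)
  have "sorted_wrt ?old (filter (\<lambda>x. x \<in> {1..m}) w)"
    using F by (auto simp: extensions_sorted_wrt elim: sorted_wrt_mono_rel[rotated])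
  then have old: "sorted_wrt ?old w"
    by (rule sorted_wrt_filter_iff[of "{1..m}" ?old w, THEN iffD2, rotated]) blast
  have trivial: "sorted_wrt P xs" if "\<forall>x \<in> set xs. \<forall>y \<in> set xs. P x y" for P and xs :: "nat list"
    using that by (simp add: sorted_wrt_iff_nth_less)
  have z: "z \<notin> set u" "z \<notin> set v" "set u \<inter> set v = {}" using dw unfolding uv by auto
  define new where "new x y \<longleftrightarrow> ?new x y" for x y
  have "sorted_wrt new u" "sorted_wrt new v"
    by (rule trivial; use z in \<open>unfold new_def, blast\<close>)+
  moreover have "\<forall>y \<in> set v. new z y" "\<forall>x \<in> set u. \<forall>y \<in> set (z # v). new x y"
    unfolding new_def list.set using u v z by blast+
  ultimately have new: "sorted_wrt new w"
    unfolding uv sorted_wrt_append sorted_wrt.simps by (intro conjI)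
  have gens: "(y, x) \<notin> gens" if "x \<in> {1..z}" "y \<in> {1..z}" "?old x y" "new x y" for x y
  proof
    assume "(y, x) \<in> gens"
    from gens_gap[OF that(2,1), THEN iffD1, OF this] show False
      using that by (auto simp: new_def)
  qed
  have "sorted_wrt (\<lambda>x y. (y, x) \<notin> gens) w"
    unfolding sorted_wrt_iff_nth_less
  proof (intro allI impI)
    fix p q assume "p < q" "q < length w"
    then show "(w ! q, w ! p) \<notin> gens"
      using old new set_w nth_mem[of p w] nth_mem[of q w]
      unfolding sorted_wrt_iff_nth_less by (intro gens) simp_all
  qed
  then show "w \<in> extensions z" using pw by (simp add: extensions_sorted_wrt)
qed

text \<open>
  The constraint between \<open>m\<close> and \<open>z\<close>, read off from a linear extension of \<open>[m]\<close> into
  which \<open>z\<close> is inserted after \<open>d\<close> letters.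
\<close>

definition cut_ok :: "nat \<Rightarrow> nat list \<Rightarrow> bool" where
  "cut_ok d l \<longleftrightarrow> m = 0 \<or> (if \<epsilon> m = Neg then m \<in> set (take d l) else m \<in> set (drop d l))"

text \<open>
  A letter of the gap is not in \<open>R\<close> and \<open>m\<close> is, so the edge at \<open>m\<close> is directed by the rule
  opposite to the one for the gap.
\<close>

lemma root_sets:
  "below_z = plus_block \<union> (if m \<noteq> 0 \<and> \<epsilon> m = Neg then {m} else {})"
  "above_z = minus_block \<union> (if m \<noteq> 0 \<and> \<epsilon> m = Pos then {m} else {})"
proof -
  have *: "i \<notin> R" if "m < i" "i < z" for i
    using gap that by (auto simp: consecutive_def)
  have s: "s \<noteq> Pos \<longleftrightarrow> s = Neg" for s by (cases s) auto
  have bm: "points_up i \<longleftrightarrow> (if i = m then \<epsilon> i = Neg else \<epsilon> i = Pos)" if "m \<le> i" "i < z" "1 \<le> i" for i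
    using *[of i] gap_bounds(4) that by (auto simp: points_up_def)
  show "below_z = plus_block \<union> (if m \<noteq> 0 \<and> \<epsilon> m = Neg then {m} else {})"
    using bm gap_bounds(1) by (auto simp: below_z_def plus_block_def split: if_splits)
  show "above_z = minus_block \<union> (if m \<noteq> 0 \<and> \<epsilon> m = Pos then {m} else {})"
    using bm gap_bounds(1) s by (auto simp: above_z_def minus_block_def split: if_splits)
qed

lemma spectrum_gap:
  assumes d: "d \<le> m"
  shows "spectrum z (d + card plus_block + 1) = fact (card plus_block) * fact (card minus_block)
      * ((d + card plus_block) choose card plus_block) * ((m - d + card minus_block) choose card minus_block) * card {l \<in> extensions m. cut_ok d l}"
proof -
  let ?f = "filter (\<lambda>x. x \<in> {1..m})"
  have "{w \<in> extensions z. w ! (d + card plus_block) = z} =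
      {w \<in> permutations_of_set (insert z ({1..m} \<union> plus_block \<union> minus_block)).
        \<exists>u v. w = u @ z # v \<and> length u = d + card plus_block \<and> plus_block \<subseteq> set u \<and> minus_block \<subseteq> set v \<and>
              ?f w \<in> {l \<in> extensions m. cut_ok d l}}" (is "?A = ?B")
  proof -
    have cut: "cut_ok d (?f w) \<longleftrightarrow> m = 0 \<or> (if \<epsilon> m = Neg then m \<in> set u else m \<in> set v)"
      if "w \<in> permutations_of_set {1..z}" "w = u @ z # v" "length u = d + card plus_block" "plus_block \<subseteq> set u" "minus_block \<subseteq> set v"
      for w u v
    proof -
      have "distinct w" "set w = insert z ({1..m} \<union> plus_block \<union> minus_block)"
        using that(1) unfolding gap_partition(7) by (auto simp: permutations_of_set_def)
      note split = filter_split_at(1,2)[OF that(2) this that(3-5) gap_partition(1,3,4,6)]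
      show ?thesis unfolding cut_ok_def split by auto
    qed
    show ?thesis
    proof (intro equalityI subsetI)
      fix w assume "w \<in> ?A"
      then have wL: "w \<in> extensions z" and nth: "w ! (d + card plus_block) = z" by auto
      from wL obtain u v where pw: "w \<in> permutations_of_set {1..z}" and F: "?f w \<in> extensions m"
        and uv: "w = u @ z # v" and u: "below_z \<subseteq> set u" and v: "above_z \<subseteq> set v"
        unfolding extensions_gap by blast
      have "d + card plus_block < length w" "length u < length w" "w ! length u = z"
        using extensions_word(1)[OF wL] gap_sizes d uv by auto
      then have len: "length u = d + card plus_block"
        using nth extensions_word(2)[OF wL] nth_eq_iff_index_eq by metis
      have blocks: "plus_block \<subseteq> set u" "minus_block \<subseteq> set v" using u v unfolding root_sets by auto
      have "cut_ok d (?f w)"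
        unfolding cut[OF pw uv len blocks] using u v unfolding root_sets by (cases "\<epsilon> m"; cases "m = 0") auto
      then show "w \<in> ?B" unfolding gap_partition(7) using pw F uv len blocks by blast
    next
      fix w assume "w \<in> ?B"
      then obtain u v where pw: "w \<in> permutations_of_set {1..z}" and F: "?f w \<in> extensions m"
        and c: "cut_ok d (?f w)"
        and uv: "w = u @ z # v" and len: "length u = d + card plus_block" and u: "plus_block \<subseteq> set u" and v: "minus_block \<subseteq> set v"
        unfolding gap_partition(7) by blast
      have "below_z \<subseteq> set u" "above_z \<subseteq> set v"
        using c u v unfolding cut[OF pw uv len u v] root_sets by (cases "\<epsilon> m"; cases "m = 0"; simp)+
      then have "w \<in> extensions z" unfolding extensions_gap using pw F uv by blast
      moreover have "w ! (d + card plus_block) = z" using uv len by (metis nth_append_length)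
      ultimately show "w \<in> ?A" by blast
    qed
  qed
  moreover have "{l \<in> extensions m. cut_ok d l} \<subseteq> permutations_of_set {1..m}"
    by (auto simp: extensions_sorted_wrt)
  ultimately show ?thesis
    using card_words_split_at[OF _ gap_partition(1,2,3,4,5,6), of "{l \<in> extensions m. cut_ok d l}" d] d
    by (simp add: spectrum_def)
qed

text \<open>
  The root comes after the whole plus block and before the whole minus block, which leaves only
  the positions \<open>d + a + 1\<close> with \<open>d \<le> m\<close>.
\<close>

lemma spectrum_gap_eq_0:
  assumes k: "k \<in> {1..z}" and no: "\<And>d. d \<le> m \<Longrightarrow> k \<noteq> d + card plus_block + 1"
  shows "spectrum z k = 0"
proof -
  have False if wL: "w \<in> extensions z" and nth: "w ! (k - 1) = z" for w
  proof -
    from wL obtain u v where uv: "w = u @ z # v" and u: "plus_block \<subseteq> set u" and v: "minus_block \<subseteq> set v"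
      unfolding extensions_gap root_sets by blast
    have "k - 1 < length w" "length u < length w" "w ! length u = z"
      using extensions_word(1)[OF wL] k uv by auto
    then have len: "length u = k - 1"
      using nth extensions_word(2)[OF wL] nth_eq_iff_index_eq by metis
    have "card plus_block \<le> length u" "card minus_block \<le> length v"
      using card_mono[OF _ u] card_mono[OF _ v] card_length[of u] card_length[of v] by auto
    moreover have "length u + length v + 1 = z" using uv extensions_word(1)[OF wL] by simp
    ultimately have "k - 1 - card plus_block \<le> m" "k = (k - 1 - card plus_block) + card plus_block + 1"
      using len k gap_sizes by auto
    then show False using no by blast
  qed
  then show ?thesis by (auto simp: spectrum_def card_eq_0_iff)
qed

lemma card_cut_ok:
  assumes "d \<le> m"
  shows "card {l \<in> extensions m. cut_ok d l} =
    (if m = 0 then 1 else case \<epsilon> m of Neg \<Rightarrow> \<Sum>t = 1..d. spectrum m t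
       | Pos \<Rightarrow> \<Sum>t = d + 1..m. spectrum m t)"
proof (cases "m = 0")
  case True
  have "extensions m = {[]}" unfolding True by (auto simp: extensions_sorted_wrt)
  then have "{l \<in> extensions m. cut_ok d l} = {[]}" unfolding cut_ok_def using True by auto
  then show ?thesis using True by simp
next
  case False
  then show ?thesis
    using card_root_in_take[OF assms] card_root_in_drop[OF assms]
    by (auto simp: cut_ok_def split: sign.split)
qed

end

section \<open>Greedy records\<close>

lemma candidates_bound: "c \<in> candidates \<epsilon> \<pi> m \<Longrightarrow> 1 \<le> c \<and> c < m"
  by (simp add: candidates_def)

lemma finite_candidates: "finite (candidates \<epsilon> \<pi> m)"
  by (rule finite_subset[of _ "{..<m}"]) (auto dest: candidates_bound)

lemma Max_candidates_less: "candidates \<epsilon> \<pi> m \<noteq> {} \<Longrightarrow> Max (candidates \<epsilon> \<pi> m) < m"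
  using Max_in[OF finite_candidates] candidates_bound by blast

lemma Rec_le: "x \<in> Rec n \<epsilon> \<pi> \<Longrightarrow> x \<le> n"
  by (induction rule: Rec.induct) (auto dest!: Max_candidates_less)

text \<open>
  The greedy procedure visits the records in decreasing order without skipping any: a record below
  \<open>x\<close> is reached from \<open>x\<close>, so it is not above the successor of \<open>x\<close>. Since \<open>Rec\<close> is only a set
  closed under the successor map, comparability along the orbit has to be proved, by one
  induction for the records above \<open>x\<close> and one for those below.
\<close>

lemma Rec_chain:
  assumes "x \<in> Rec n \<epsilon> \<pi>" "y \<in> Rec n \<epsilon> \<pi>" "y < x"
  shows "candidates \<epsilon> \<pi> x \<noteq> {} \<and> y \<le> Max (candidates \<epsilon> \<pi> x)"
proof -
  let ?f = "\<lambda>x. Max (candidates \<epsilon> \<pi> x)"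
  let ?ne = "\<lambda>x. candidates \<epsilon> \<pi> x \<noteq> {}"
  have below: "y < x \<longrightarrow> ?ne x \<and> y \<le> ?f x"
    if "y \<in> Rec n \<epsilon> \<pi>" and above: "\<And>y. y \<in> Rec n \<epsilon> \<pi> \<Longrightarrow> x < y \<Longrightarrow> ?ne y \<and> x \<le> ?f y"
      and "x \<le> n" for x y
    using that(1)
  proof (induction rule: Rec.induct)
    case start
    then show ?case using that(3) by simp
  next
    case (step i)
    then show ?case
      using above[OF step.hyps(1)] Max_candidates_less[OF step.hyps(2)]
      by (cases x i rule: linorder_cases) auto
  qed
  have "(\<forall>y \<in> Rec n \<epsilon> \<pi>. x < y \<longrightarrow> ?ne y \<and> x \<le> ?f y)" if "x \<in> Rec n \<epsilon> \<pi>" for x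
    using that
  proof (induction rule: Rec.induct)
    case start
    then show ?case using Rec_le leD by blast
  next
    case (step i)
    show ?case
    proof (intro ballI impI)
      fix y assume y: "y \<in> Rec n \<epsilon> \<pi>" "?f i < y"
      have "i < y \<Longrightarrow> ?ne y \<and> i \<le> ?f y" using step.IH y by blast
      moreover have "\<not> y < i"
        using below[of y i, OF y(1)] step.IH Rec_le[OF step.hyps(1)] y(2) by auto
      ultimately show "?ne y \<and> ?f i \<le> ?f y"
        using step.hyps(2) Max_candidates_less[OF step.hyps(2)]
        by (cases i y rule: linorder_cases) auto
    qed
  qed
  then show ?thesis
    using below[of y x] assms Rec_le by blast
qed

context record_set
begin

text \<open>
  The record condition, localized at single letters: \<open>i\<close> is eligible for the greedy step from the next
  root \<open>\<rho>\<^sub>R(i)\<close> exactly if it is a root.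
\<close>

definition greedy :: "(nat \<Rightarrow> nat) \<Rightarrow> bool" where
  "greedy \<pi> \<longleftrightarrow> (\<forall>i. 1 \<le> i \<and> i < n \<longrightarrow> (i \<in> R \<longleftrightarrow> i \<in> candidates \<epsilon> \<pi> (rho R i)))"

text \<open>
  For \<open>i \<notin> R\<close> the letter must fail to be a candidate, which by injectivity of \<open>\<pi>\<close> reverses the
  inequality; this is why the edges at roots and at other letters follow opposite sign rules.
\<close>

lemma greedy_iff_mono:
  assumes inj: "inj_on \<pi> {1..n}"
  shows "greedy \<pi> \<longleftrightarrow> (\<forall>(x, y) \<in> gens. \<pi> x < \<pi> y)"
proof -
  have "(i \<in> R \<longleftrightarrow> i \<in> candidates \<epsilon> \<pi> (rho R i))
      \<longleftrightarrow> (if points_up i then \<pi> i < \<pi> (rho R i) else \<pi> (rho R i) < \<pi> i)" if i: "1 \<le> i" "i < n" for i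
  proof -
    have "\<pi> i \<noteq> \<pi> (rho R i)"
    proof -
      have "rho R i \<in> {1..n}" "i \<in> {1..n}" using rho(1)[OF i(2)] i R_subset by auto
      then show ?thesis using inj_on_eq_iff[OF inj] rho(2)[OF i(2)] by fastforce
    qed
    then show ?thesis
      using i rho(2)[OF i(2)] by (cases "\<epsilon> i") (auto simp: candidates_def points_up_def)
  qed
  then have "greedy \<pi> \<longleftrightarrow> (\<forall>i. 1 \<le> i \<and> i < n \<longrightarrow>
      (if points_up i then \<pi> i < \<pi> (rho R i) else \<pi> (rho R i) < \<pi> i))"
    unfolding greedy_def by blast
  also have "\<dots> \<longleftrightarrow> (\<forall>(x, y) \<in> gens. \<pi> x < \<pi> y)"
    by (auto simp: gens_iff split: if_splits)
  finally show ?thesis .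
qed

lemma rho_between:
  assumes "r < n" "r \<le> c" "c < rho R r"
  shows "rho R c = rho R r" and "r < c \<Longrightarrow> c \<notin> R"
proof -
  have "rho R r \<le> n" using rho(1)[OF assms(1)] R_subset by auto
  then have "c < n" using assms by simp
  have "rho R c \<le> rho R r" by (rule rho(3)[OF \<open>c < n\<close> rho(1)[OF assms(1)] assms(3)])
  moreover have "rho R r \<le> rho R c"
    using rho(3)[OF assms(1) rho(1)[OF \<open>c < n\<close>]] rho(2)[OF \<open>c < n\<close>] assms by simp
  ultimately show "rho R c = rho R r" by simp
  show "c \<notin> R" if "r < c"
    using rho(3)[OF assms(1), of c] that assms(3) by auto
qed

text \<open>
  Under the local condition the largest candidate at the root that follows \<open>r \<in> R\<close> is \<open>r\<close>
  itself: every larger candidate would be a root strictly between two consecutive ones.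
\<close>

lemma Rec_eq_if_greedy:
  assumes g: "greedy \<pi>"
  shows "Rec n \<epsilon> \<pi> = R"
proof
  have gD: "i \<in> R \<longleftrightarrow> i \<in> candidates \<epsilon> \<pi> (rho R i)" if "1 \<le> i" "i < n" for i
    using g that by (simp add: greedy_def)
  have R1: "r \<ge> 1" "r \<le> n" if "r \<in> R" for r using R_subset that by auto
  have max_cand: "candidates \<epsilon> \<pi> (rho R r) \<noteq> {}" "Max (candidates \<epsilon> \<pi> (rho R r)) = r"
    if r: "r \<in> R" "r < n" for r
  proof -
    have rc: "r \<in> candidates \<epsilon> \<pi> (rho R r)" using gD R1 r by blast
    then show "candidates \<epsilon> \<pi> (rho R r) \<noteq> {}" by blast
    have "c \<le> r" if c: "c \<in> candidates \<epsilon> \<pi> (rho R r)" for c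
    proof (rule ccontr)
      assume "\<not> c \<le> r"
      then have "r < c" by simp
      have "c < rho R r" "1 \<le> c" using candidates_bound[OF c] by auto
      moreover have "c < n" using \<open>c < rho R r\<close> rho(1)[OF r(2)] R1 by fastforce
      ultimately have "c \<in> R" using gD[of c] rho_between(1)[OF r(2), of c] \<open>r < c\<close> c by simp
      then show False using rho_between(2)[OF r(2), of c] \<open>r < c\<close> \<open>c < rho R r\<close> by simp
    qed
    then show "Max (candidates \<epsilon> \<pi> (rho R r)) = r"
      using rc finite_candidates by (intro Max_eqI) auto
  qed
  show "R \<subseteq> Rec n \<epsilon> \<pi>"
  proof
    fix r assume "r \<in> R"
    then show "r \<in> Rec n \<epsilon> \<pi>"
    proof (induction "n - r" arbitrary: r rule: less_induct)
      case less
      show ?case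
      proof (cases "r = n")
        case True
        then show ?thesis by (simp add: Rec.start)
      next
        case False
        then have "r < n" using R1 less.prems by fastforce
        moreover have "rho R r \<in> Rec n \<epsilon> \<pi>"
          using less.hyps[of "rho R r"] rho(1,2)[OF \<open>r < n\<close>] \<open>r < n\<close> by simp
        ultimately show ?thesis
          using Rec.step[of "rho R r" n \<epsilon> \<pi>] max_cand[OF less.prems] by simp
      qed
    qed
  qed
  show "Rec n \<epsilon> \<pi> \<subseteq> R"
  proof
    fix x assume "x \<in> Rec n \<epsilon> \<pi>"
    then show "x \<in> R"
    proof (induction rule: Rec.induct)
      case start
      show ?case by (rule n_in_R)
    next
      case (step i)
      define c where "c = Max (candidates \<epsilon> \<pi> i)"
      have c: "c \<in> candidates \<epsilon> \<pi> i" unfolding c_def using Max_in[OF finite_candidates step.hyps(2)] .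
      then have b: "1 \<le> c" "c < i" "i \<le> n" using candidates_bound R1[OF step.IH] by auto
      show ?case
      proof (cases "{r \<in> R. c \<le> r \<and> r < i} = {}")
        case True
        have "c < n" using b by simp
        have "rho R c \<le> i" by (rule rho(3)[OF \<open>c < n\<close> step.IH b(2)])
        moreover have "\<not> rho R c < i" using True rho(1,2)[OF \<open>c < n\<close>] by auto
        ultimately have "rho R c = i" by simp
        then show ?thesis using gD[of c] c b by (simp add: c_def)
      next
        case False
        \<comment> \<open>The last root before \<open>i\<close> is the largest candidate at \<open>i\<close>, hence equal to \<open>c\<close>.\<close>
        define r where "r = Max {r \<in> R. c \<le> r \<and> r < i}"
        have fin: "finite {r \<in> R. c \<le> r \<and> r < i}" using finite_R by simp
        have r: "r \<in> R" "c \<le> r" "r < i" using Max_in[OF fin False] by (auto simp: r_def)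
        have "r < n" using r b by simp
        have "\<not> rho R r < i"
        proof
          assume "rho R r < i"
          then have "rho R r \<in> {r \<in> R. c \<le> r \<and> r < i}" using rho(1,2)[OF \<open>r < n\<close>] r by simp
          then have "rho R r \<le> r" unfolding r_def using Max_ge[OF fin] by blast
          then show False using rho(2)[OF \<open>r < n\<close>] by simp
        qed
        then have "rho R r = i" using rho(3)[OF \<open>r < n\<close> step.IH r(3)] by simp
        then have "c = r" using max_cand(2)[OF r(1) \<open>r < n\<close>] by (simp add: c_def)
        then show ?thesis using r by (simp add: c_def)
      qed
    qed
  qed
qed

text \<open>
  A candidate at \<open>\<rho>\<^sub>R(i)\<close> larger than \<open>i\<close> would lead to a record strictly between \<open>i\<close> and \<open>\<rho>\<^sub>R(i)\<close>.
  Hence \<open>i\<close>, if it is a candidate, is the largest and becomes a record; and if it is a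
  record, it is reached from \<open>\<rho>\<^sub>R(i)\<close>.
\<close>

lemma greedy_if_Rec_eq:
  assumes Rec: "Rec n \<epsilon> \<pi> = R"
  shows "greedy \<pi>"
  unfolding greedy_def
proof (intro allI impI)
  fix i assume "1 \<le> i \<and> i < n"
  then have i: "1 \<le> i" "i < n" by auto
  let ?z = "rho R i"
  have z: "?z \<in> Rec n \<epsilon> \<pi>" "i < ?z" using rho(1,2)[OF i(2)] Rec by auto
  have max_le: "candidates \<epsilon> \<pi> ?z \<noteq> {} \<Longrightarrow> Max (candidates \<epsilon> \<pi> ?z) \<le> i"
    using Rec.step[OF z(1)] rho(3)[OF i(2)] Max_candidates_less[of \<epsilon> \<pi> ?z] Rec
    by (meson leD leI)
  show "i \<in> R \<longleftrightarrow> i \<in> candidates \<epsilon> \<pi> ?z"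
  proof
    assume "i \<in> R"
    then have *: "candidates \<epsilon> \<pi> ?z \<noteq> {}" "i \<le> Max (candidates \<epsilon> \<pi> ?z)"
      using Rec_chain[OF z(1) _ z(2)] Rec by auto
    then have "i = Max (candidates \<epsilon> \<pi> ?z)" using max_le by simp
    then show "i \<in> candidates \<epsilon> \<pi> ?z" using Max_in[OF finite_candidates *(1)] by simp
  next
    assume c: "i \<in> candidates \<epsilon> \<pi> ?z"
    then have "i \<le> Max (candidates \<epsilon> \<pi> ?z)" using Max_ge[OF finite_candidates] by blast
    with c max_le have "i = Max (candidates \<epsilon> \<pi> ?z)" by (intro antisym) auto
    then show "i \<in> R" using Rec.step[OF z(1)] c Rec by auto
  qed
qed

lemma Rec_eq_iff: 
  assumes "\<pi> permutes {1..n}"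
  shows "Rec n \<epsilon> \<pi> = R \<longleftrightarrow> (\<forall>(x, y) \<in> gens. \<pi> x < \<pi> y)"
  using Rec_eq_if_greedy greedy_if_Rec_eq greedy_iff_mono[OF permutes_inj_on[OF assms]] by blast

text \<open>
  The word of \<open>\<pi>\<inverse>\<close> has the letter \<open>x\<close> at position \<open>\<pi>(x)\<close>.
\<close>

lemma card_mono_permutations:
  "card {\<pi>. \<pi> permutes {1..n} \<and> (\<forall>(x, y) \<in> gens. \<pi> x < \<pi> y)} = card (extensions n)"
proof -
  let ?w = "\<lambda>\<pi>. map (inv \<pi>) [1..<Suc n]"
  let ?A = "{\<pi>. \<pi> permutes {1..n} \<and> (\<forall>(x, y) \<in> gens. \<pi> x < \<pi> y)}"
  have set_upt: "set [1..<Suc n] = {1..n}" by auto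
  have "bij_betw ?w ?A (extensions n)"
  proof (rule bij_betw_imageI)
    show "inj_on ?w ?A"
    proof (rule inj_onI)
      fix \<pi> \<pi>' assume \<pi>: "\<pi> \<in> ?A" "\<pi>' \<in> ?A" and eq: "?w \<pi> = ?w \<pi>'"
      then have "inv \<pi> permutes {1..n}" "inv \<pi>' permutes {1..n}"
        by (auto intro: permutes_inv)
      moreover have "\<forall>x \<in> {1..n}. inv \<pi> x = inv \<pi>' x"
        using eq unfolding map_eq_conv set_upt .
      ultimately have "inv \<pi> = inv \<pi>'"
        by (metis ext permutes_not_in)
      then have "inv (inv \<pi>) = inv (inv \<pi>')" by simp
      moreover have "bij \<pi>" "bij \<pi>'" using \<pi> permutes_bij by blast+
      ultimately show "\<pi> = \<pi>'" by (simp add: inv_inv_eq)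
    qed
    show "?w ` ?A = extensions n"
    proof (intro equalityI subsetI)
      fix w assume "w \<in> ?w ` ?A"
      then obtain \<pi> where \<pi>: "\<pi> permutes {1..n}" and mono: "\<forall>(x, y) \<in> gens. \<pi> x < \<pi> y"
        and w: "w = ?w \<pi>" by auto
      have "set w = inv \<pi> ` {1..n}" unfolding w set_map set_upt ..
      also have "\<dots> = {1..n}" by (rule permutes_image[OF permutes_inv[OF \<pi>]])
      finally have set_w: "set w = {1..n}" .
      moreover have "distinct w"
        unfolding w distinct_map using permutes_inj_on[OF permutes_inv[OF \<pi>]] by simp
      moreover have "p < q" if "p < length w" "q < length w" "(w ! p, w ! q) \<in> gens" for p q
      proof -
        have "\<pi> (w ! p) = Suc p" "\<pi> (w ! q) = Suc q"
          using that(1,2) permutes_inverses(1)[OF \<pi>] unfolding w by (auto simp del: upt_Suc)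
        then show ?thesis using mono that(3) by fastforce
      qed
      ultimately show "w \<in> extensions n"
        by (auto simp: extensions_def linear_extensions_def permutations_of_set_def)
    next
      fix w assume w: "w \<in> extensions n"
      define \<tau> where "\<tau> i = (if i \<in> {1..n} then w ! (i - 1) else i)" for i
      note lw = extensions_word[OF w]
      have "inj_on \<tau> {1..n}"
      proof (rule inj_onI)
        fix i j assume "i \<in> {1..n}" "j \<in> {1..n}" "\<tau> i = \<tau> j"
        then have "i - 1 = j - 1"
          using lw nth_eq_iff_index_eq[of w "i - 1" "j - 1"] by (auto simp: \<tau>_def)
        then show "i = j" using \<open>i \<in> {1..n}\<close> \<open>j \<in> {1..n}\<close> by auto
      qed
      moreover have "\<tau> ` {1..n} \<subseteq> {1..n}"
      proof -
        have "w ! (i - 1) \<in> {1..n}" if "i \<in> {1..n}" for i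
          using nth_mem[of "i - 1" w] lw that by auto
        then show ?thesis by (auto simp: \<tau>_def)
      qed
      ultimately have "bij_betw \<tau> {1..n} {1..n}"
        by (simp add: bij_betw_def endo_inj_surj)
      then have \<tau>: "\<tau> permutes {1..n}" by (rule bij_imp_permutes) (auto simp: \<tau>_def)
      have "inv (inv \<tau>) = \<tau>" by (rule inv_inv_eq[OF permutes_bij[OF \<tau>]])
      then have "?w (inv \<tau>) = map \<tau> [1..<Suc n]" by simp
      also have "\<dots> = w"
        by (rule nth_equalityI) (use lw in \<open>auto simp: \<tau>_def simp del: upt_Suc\<close>)
      finally have "?w (inv \<tau>) = w" .
      moreover have "inv \<tau> x < inv \<tau> y" if xy: "(x, y) \<in> gens" for x y
      proof -
        have "x \<in> {1..n}" "y \<in> {1..n}" using gens_subset xy by auto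
        then have in_n: "inv \<tau> x \<in> {1..n}" "inv \<tau> y \<in> {1..n}"
          using permutes_in_image[OF permutes_inv[OF \<tau>]] by auto
        moreover have "\<tau> (inv \<tau> x) = x" "\<tau> (inv \<tau> y) = y"
          using permutes_inverses(1)[OF \<tau>] by auto
        ultimately have "w ! (inv \<tau> x - 1) = x" "w ! (inv \<tau> y - 1) = y" by (auto simp: \<tau>_def)
        moreover have "inv \<tau> x - 1 < length w" "inv \<tau> y - 1 < length w"
          using in_n lw by auto
        ultimately have "inv \<tau> x - 1 < inv \<tau> y - 1"
          using w xy unfolding extensions_def linear_extensions_def by (metis (no_types, lifting) mem_Collect_eq)
        then show ?thesis by simp
      qed
      moreover have "inv \<tau> permutes {1..n}" by (rule permutes_inv[OF \<tau>])
      ultimately show "w \<in> ?w ` ?A" by (intro image_eqI[of _ _ "inv \<tau>"]) auto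
    qed
  qed
  then show ?thesis by (rule bij_betw_same_card)
qed

lemma card_Rec_eq:
  "card {\<pi>. \<pi> permutes {1..n} \<and> Rec n \<epsilon> \<pi> = R} = (\<Sum>k = 1..n. spectrum n k)"
proof -
  have "{\<pi>. \<pi> permutes {1..n} \<and> Rec n \<epsilon> \<pi> = R}
      = {\<pi>. \<pi> permutes {1..n} \<and> (\<forall>(x, y) \<in> gens. \<pi> x < \<pi> y)}"
    using Rec_eq_iff by blast
  then show ?thesis by (simp only: card_mono_permutations card_extensions[OF n_pos])
qed

section \<open>Spectra of the indexed roots\<close>

lemma root_at_mem: "root_at R j \<in> R" if "1 \<le> j" "j \<le> card R"
  using that finite_R nth_mem[of "j - 1" "sorted_list_of_set R"] by (simp add: root_at_def)

lemma root_at_less: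
  assumes "i < j" "j \<le> card R"
  shows "root_at R i < root_at R j"
proof (cases "i = 0")
  case True
  then show ?thesis using root_at_mem[of j] assms R_subset by (force simp: root_at_def)
next
  case False
  then show ?thesis
    using assms strict_sorted_list_of_set[of R]
    by (simp add: root_at_def sorted_wrt_iff_nth_less)
qed

lemma consecutive_root_at:
  assumes "1 \<le> j" "j \<le> card R"
  shows "consecutive (root_at R (j - 1)) (root_at R j)"
  unfolding consecutive_def
proof (intro conjI ballI)
  show "root_at R (j - 1) = 0 \<or> root_at R (j - 1) \<in> R"
    using root_at_mem[of "j - 1"] assms by (cases "j = 1") (auto simp: root_at_def)
  show "root_at R j \<in> R" by (rule root_at_mem[OF assms])
  show "root_at R (j - 1) < root_at R j" using assms by (intro root_at_less) auto
  fix x assume "x \<in> R"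
  then obtain p where p: "p < card R" "x = sorted_list_of_set R ! p"
    using finite_R by (metis in_set_conv_nth length_sorted_list_of_set set_sorted_list_of_set)
  then have x: "x = root_at R (Suc p)" by (simp add: root_at_def)
  show "\<not> (root_at R (j - 1) < x \<and> x < root_at R j)"
  proof
    assume *: "root_at R (j - 1) < x \<and> x < root_at R j"
    have "\<not> Suc p \<ge> j"
      using * root_at_less[of j "Suc p"] p(1) x by (cases "j = Suc p") auto
    moreover have "\<not> Suc p \<le> j - 1"
      using * root_at_less[of "Suc p" "j - 1"] assms x by (cases "j - 1 = Suc p") force+
    ultimately show False by linarith
  qed
qed

lemma card_R_pos: "card R \<ge> 1"
proof -
  have "R \<noteq> {}" using n_in_R by blast
  then show ?thesis using finite_R by (simp add: Suc_le_eq card_gt_0_iff)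
qed

lemma root_at_card: "root_at R (card R) = n"
proof (rule ccontr)
  assume "root_at R (card R) \<noteq> n"
  moreover have "root_at R (card R) \<in> R" using root_at_mem card_R_pos by blast
  ultimately have less: "root_at R (card R) < n" using R_subset by fastforce
  obtain p where "p < card R" "n = sorted_list_of_set R ! p"
    using finite_R n_in_R by (metis in_set_conv_nth length_sorted_list_of_set set_sorted_list_of_set)
  then have "n = root_at R (Suc p)" "Suc p \<le> card R" by (auto simp: root_at_def)
  then show False using less root_at_less[of "Suc p" "card R"] by (cases "Suc p = card R") auto
qed

lemma root_spectrum_eq:
  assumes "1 \<le> j" "j \<le> card R"
  shows "root_spectrum n \<epsilon> R j k = spectrum (root_at R j) k"
  unfolding root_spectrum_def sub_poset_def spectrum_def
    linear_extensions_record_poset[OF root_at_mem[OF assms]] ..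

lemma ell_eq: "ell n \<epsilon> R k = spectrum n k"
proof -
  have "record_poset n \<epsilon> R \<subseteq> {1..n} \<times> {1..n}"
    unfolding record_poset_def by (rule trancl_subset_Sigma[OF gens_subset])
  then have "Restr (record_poset n \<epsilon> R) {1..n} = record_poset n \<epsilon> R" by blast
  then show ?thesis
    using linear_extensions_record_poset[OF n_in_R] by (simp add: ell_def spectrum_def)
qed

text \<open>
  For the first root there is no previous spectrum to sum: the empty word is the only
  linear extension of the empty poset, and no side is prescribed.
\<close>

definition cut_count :: "nat \<Rightarrow> nat \<Rightarrow> nat" where
  "cut_count j d = (if j = 1 then 1 else C_sum n \<epsilon> R j d)"

lemma root_spectrum_step:
  assumes j: "1 \<le> j" "j \<le> card R" and d: "d \<le> root_at R (j - 1)"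
  shows "root_spectrum n \<epsilon> R j (d + a_count \<epsilon> R j + 1) =
    fact (a_count \<epsilon> R j) * fact (b_count \<epsilon> R j) * ((d + a_count \<epsilon> R j) choose (a_count \<epsilon> R j))
      * ((root_at R (j - 1) - d + b_count \<epsilon> R j) choose (b_count \<epsilon> R j)) * cut_count j d"
proof -
  interpret record_gap n \<epsilon> R "root_at R (j - 1)" "root_at R j"
    by unfold_locales (rule consecutive_root_at[OF j])
  have ab: "a_count \<epsilon> R j = card plus_block" "b_count \<epsilon> R j = card minus_block"
    unfolding sign_count_def plus_block_def minus_block_def by (rule refl)+
  have "root_at R (j - 1) = 0 \<longleftrightarrow> j = 1"
    using root_at_less[of 0 "j - 1"] j by (cases "j = 1") (auto simp: root_at_def)
  moreover have "root_spectrum n \<epsilon> R (j - 1) t = spectrum (root_at R (j - 1)) t" if "j \<noteq> 1" for t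
    using that j by (intro root_spectrum_eq) auto
  ultimately have "card {l \<in> extensions (root_at R (j - 1)). cut_ok d l} = cut_count j d"
    using card_cut_ok[OF d] by (auto simp: cut_count_def C_sum_def split: sign.split)
  then show ?thesis
    using spectrum_gap[OF d] root_spectrum_eq[OF j] ab by simp
qed

lemma root_spectrum_eq_0:
  assumes j: "1 \<le> j" "j \<le> card R" and k: "k \<in> {1..root_at R j}"
    and no: "\<And>d. d \<le> root_at R (j - 1) \<Longrightarrow> k \<noteq> d + a_count \<epsilon> R j + 1"
  shows "root_spectrum n \<epsilon> R j k = 0"
proof -
  interpret record_gap n \<epsilon> R "root_at R (j - 1)" "root_at R j"
    by unfold_locales (rule consecutive_root_at[OF j])
  have "a_count \<epsilon> R j = card plus_block" unfolding sign_count_def plus_block_def by (rule refl)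
  then show ?thesis
    using spectrum_gap_eq_0[OF k] no root_spectrum_eq[OF j] by simp
qed

lemma block_sizes:
  assumes j: "1 \<le> j" "j \<le> card R"
  shows "root_at R (j - 1) + a_count \<epsilon> R j + b_count \<epsilon> R j + 1 = root_at R j"
proof -
  interpret record_gap n \<epsilon> R "root_at R (j - 1)" "root_at R j"
    by unfold_locales (rule consecutive_root_at[OF j])
  show ?thesis using gap_sizes unfolding sign_count_def plus_block_def minus_block_def .
qed

end

section \<open>Programs with step bounds\<close>

text \<open>
  A total-correctness judgement for a run from a fixed memory: the final memory satisfies \<open>Q\<close> and at
  most \<open>B\<close> steps are taken.
\<close>

definition runs :: "prog \<Rightarrow> memory \<Rightarrow> (memory \<Rightarrow> bool) \<Rightarrow> nat \<Rightarrow> bool" where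
  "runs c M Q B \<longleftrightarrow> Q (fst (run c M)) \<and> snd (run c M) \<le> B"

lemma runs_mono: "runs c M Q B \<Longrightarrow> (\<And>M'. Q M' \<Longrightarrow> Q' M') \<Longrightarrow> B \<le> B' \<Longrightarrow> runs c M Q' B'"
  by (auto simp: runs_def)

lemma runs_Seq:
  "runs c1 M Q1 B1 \<Longrightarrow> (\<And>M'. Q1 M' \<Longrightarrow> runs c2 M' Q B2) \<Longrightarrow> runs (Seq c1 c2) M Q (B1 + B2)"
  by (fastforce simp: runs_def case_prod_beta Let_def intro: add_mono)

text \<open>
  The invariant speaks of the memory before the counter \<open>x\<close> is set; the new value of \<open>x\<close> is visible
  to the body only.
\<close>

lemma runs_For:
  assumes N: "eval_expr e M = N" and "I 0 M"
    and step: "\<And>i M'. i < N \<Longrightarrow> I i M' \<Longrightarrow> runs c (store x 0 0 i M') (I (Suc i)) B"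
  shows "runs (For x e c) M (I N) (1 + expr_steps e + N * (B + 1))"
proof -
  define body where
    "body = (\<lambda>i (M1, t1). let (M2, t2) = run c (store x 0 0 i M1) in (M2, t1 + 1 + t2 :: nat))"
  have "I k (fst (fold body [0..<k] (M, t))) \<and> snd (fold body [0..<k] (M, t)) \<le> t + k * (B + 1)"
    if "k \<le> N" for k t
    using that
  proof (induction k)
    case 0
    then show ?case using assms(2) by simp
  next
    case (Suc k)
    obtain M' t' where eq: "fold body [0..<k] (M, t) = (M', t')" by fastforce
    then have "I k M'" "t' \<le> t + k * (B + 1)" using Suc by auto
    moreover have "fold body [0..<Suc k] (M, t) = body k (M', t')" by (simp add: eq)
    moreover have "body k (M', t') = (fst (run c (store x 0 0 k M')), t' + 1 + snd (run c (store x 0 0 k M')))"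
      by (simp add: body_def case_prod_beta)
    ultimately show ?case
      using step[of k M'] Suc.prems by (auto simp: runs_def)
  qed
  from this[of N "1 + expr_steps e"] show ?thesis
    by (simp add: runs_def N body_def)
qed

lemma store_apply: "store x p q v M y = (if y = x then (M x)(p := (M x p)(q := v)) else M y)"
  by (simp add: store_def)

abbreviation var :: "string \<Rightarrow> expr" where "var x \<equiv> Cell x (Const 0) (Const 0)"
abbreviation assign :: "string \<Rightarrow> expr \<Rightarrow> prog" where "assign x e \<equiv> Assign x (Const 0) (Const 0) e"

section \<open>The quadratic algorithm\<close>

text \<open>
  The lemma on each loop below describes its effect in terms of the initial memory: the new contents
  of its result, which arrays it leaves alone where the code after it relies on them, and a generous
  step bound linear in the number of iterations.

  The scalars \<open>m\<close>, \<open>z\<close>, \<open>a\<close>, \<open>b\<close> hold the two ends of the current gap and its numbers of plus and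
  minus letters. Row \<open>j\<close> of the array \<open>H\<close> holds the spectrum of \<open>r\<^sub>j\<close>, and row \<open>j\<close> of \<open>T\<close> its
  prefix sums.
\<close>

definition count_plus :: prog where
  "count_plus = For ''i'' (Sub (Sub (var ''z'') (var ''m'')) (Const 1))
     (IfLe (Const 1) (Cell ''eps'' (Add (Add (var ''m'') (var ''i'')) (Const 1)) (Const 0))
        (assign ''a'' (Add (var ''a'') (Const 1)))
        (assign ''a'' (var ''a'')))"

lemma runs_count_plus:
  assumes m: "M ''m'' 0 0 = m" and z: "M ''z'' 0 0 = z" and a: "M ''a'' 0 0 = 0"
  shows "runs count_plus M (\<lambda>M'. (\<forall>x. x \<notin> {''i'', ''a''} \<longrightarrow> M' x = M x) \<and>
      M' ''a'' 0 0 = card {p. m < p \<and> p \<le> m + (z - m - 1) \<and> 1 \<le> M ''eps'' p 0}) (20 + (z - m - 1) * 30)"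
proof -
  define I where "I i M' \<longleftrightarrow> (\<forall>x. x \<notin> {''i'', ''a''} \<longrightarrow> M' x = M x) \<and>
      M' ''a'' 0 0 = card {p. m < p \<and> p \<le> m + i \<and> 1 \<le> M ''eps'' p 0}" for i M'
  have "runs count_plus M (I (z - m - 1))
     (1 + expr_steps (Sub (Sub (var ''z'') (var ''m'')) (Const 1)) + (z - m - 1) * (28 + 1))"
    unfolding count_plus_def
  proof (rule runs_For)
    show "eval_expr (Sub (Sub (var ''z'') (var ''m'')) (Const 1)) M = z - m - 1"
      by (simp add: m z)
    show "I 0 M" using a by (simp add: I_def)
    fix i M' assume I: "I i M'"
    let ?P = "\<lambda>i. {p. m < p \<and> p \<le> m + i \<and> 1 \<le> M ''eps'' p 0}"
    have fin: "finite (?P i)" by (rule finite_subset[of _ "{..m + i}"]) auto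
    have P: "?P (Suc i) = (if 1 \<le> M ''eps'' (m + i + 1) 0 then insert (m + i + 1) (?P i) else ?P i)"
      by (auto simp: le_Suc_eq)
    have "card (?P (Suc i)) = card (?P i) + (if 1 \<le> M ''eps'' (m + i + 1) 0 then 1 else 0)"
      unfolding P using fin by simp
    then show "runs (IfLe (Const 1) (Cell ''eps'' (Add (Add (var ''m'') (var ''i'')) (Const 1)) (Const 0))
        (assign ''a'' (Add (var ''a'') (Const 1)))
        (assign ''a'' (var ''a''))) (store ''i'' 0 0 i M') (I (Suc i)) 28"
      using I m by (simp add: runs_def I_def store_apply)
  qed
  then show ?thesis by (rule runs_mono) (auto simp: I_def)
qed

text \<open>
  The partial sum required by a plus sign is the total minus a prefix sum. For \<open>m = 0\<close> the sign cell
  that is read is initially 0, so that the first root takes the branch for minus.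
\<close>

definition fill_row :: prog where
  "fill_row = For ''d'' (Add (var ''m'') (Const 1))
     (Seq
       (IfLe (Const 1) (Cell ''eps'' (var ''m'') (Const 0))
         (assign ''c'' (Sub (Cell ''T'' (var ''j'') (var ''m'')) (Cell ''T'' (var ''j'') (var ''d''))))
         (assign ''c'' (Cell ''T'' (var ''j'') (var ''d''))))
       (Assign ''H'' (Add (var ''j'') (Const 1)) (Add (Add (var ''d'') (var ''a'')) (Const 1))
         (Mul (Mul (Mul (Mul (Cell ''fact'' (var ''a'') (Const 0)) (Cell ''fact'' (var ''b'') (Const 0)))
           (Cell ''binom'' (Add (var ''d'') (var ''a'')) (var ''a'')))
           (Cell ''binom'' (Add (Sub (var ''m'') (var ''d'')) (var ''b'')) (var ''b'')))
           (var ''c''))))"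

definition row_entry :: "memory \<Rightarrow> nat \<Rightarrow> nat \<Rightarrow> nat \<Rightarrow> nat \<Rightarrow> nat \<Rightarrow> nat" where
  "row_entry M j m a b d = M ''fact'' a 0 * M ''fact'' b 0 * M ''binom'' (d + a) a
      * M ''binom'' (m - d + b) b
      * (if 1 \<le> M ''eps'' m 0 then M ''T'' j m - M ''T'' j d else M ''T'' j d)"

lemma runs_fill_row:
  assumes "M ''j'' 0 0 = j" "M ''m'' 0 0 = m" "M ''a'' 0 0 = a" "M ''b'' 0 0 = b"
  shows "runs fill_row M (\<lambda>M'. (\<forall>x. x \<notin> {''d'', ''c'', ''H''} \<longrightarrow> M' x = M x) \<and>
      M' ''H'' = (M ''H'')(Suc j := (\<lambda>k. if a < k \<and> k \<le> a + (m + 1) then row_entry M j m a b (k - a - 1)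
                                         else M ''H'' (Suc j) k))) (10 + (m + 1) * 200)"
proof -
  define I where "I d M' \<longleftrightarrow> (\<forall>x. x \<notin> {''d'', ''c'', ''H''} \<longrightarrow> M' x = M x) \<and>
      M' ''H'' = (M ''H'')(Suc j := (\<lambda>k. if a < k \<and> k \<le> a + d then row_entry M j m a b (k - a - 1)
                                         else M ''H'' (Suc j) k))" for d M'
  have "runs fill_row M (I (m + 1)) (1 + expr_steps (Add (var ''m'') (Const 1)) + (m + 1) * (150 + 1))"
    unfolding fill_row_def
  proof (rule runs_For)
    show "eval_expr (Add (var ''m'') (Const 1)) M = m + 1" by (simp add: assms)
    show "I 0 M" by (simp add: I_def fun_upd_idem_iff fun_eq_iff)
    fix d M' assume I: "I d M'"
    have upd: "(\<lambda>k. if a < k \<and> k \<le> a + d then f (k - a - 1) else g k)(Suc (d + a) := f d)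
        = (\<lambda>k. if a < k \<and> k \<le> a + Suc d then f (k - a - 1) else g k)" for f g :: "nat \<Rightarrow> nat"
      by (auto simp: fun_eq_iff le_Suc_eq)
    show "runs (Seq
       (IfLe (Const 1) (Cell ''eps'' (var ''m'') (Const 0))
         (assign ''c'' (Sub (Cell ''T'' (var ''j'') (var ''m'')) (Cell ''T'' (var ''j'') (var ''d''))))
         (assign ''c'' (Cell ''T'' (var ''j'') (var ''d''))))
       (Assign ''H'' (Add (var ''j'') (Const 1)) (Add (Add (var ''d'') (var ''a'')) (Const 1))
         (Mul (Mul (Mul (Mul (Cell ''fact'' (var ''a'') (Const 0)) (Cell ''fact'' (var ''b'') (Const 0)))
           (Cell ''binom'' (Add (var ''d'') (var ''a'')) (var ''a'')))
           (Cell ''binom'' (Add (Sub (var ''m'') (var ''d'')) (var ''b'')) (var ''b'')))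
           (var ''c'')))) (store ''d'' 0 0 d M') (I (Suc d)) 150"
    proof (cases "1 \<le> M ''eps'' m 0")
      case True
      then have "M ''fact'' a 0 * M ''fact'' b 0 * M ''binom'' (d + a) a * M ''binom'' (m - d + b) b
          * (M ''T'' j m - M ''T'' j d) = row_entry M j m a b d"
        by (simp add: row_entry_def)
      then show ?thesis
        using I assms True upd[of "row_entry M j m a b" "M ''H'' (Suc j)"]
        by (simp add: runs_def I_def store_apply)
    next
      case False
      then have "M ''fact'' a 0 * M ''fact'' b 0 * M ''binom'' (d + a) a * M ''binom'' (m - d + b) b
          * M ''T'' j d = row_entry M j m a b d"
        by (simp add: row_entry_def)
      then show ?thesis
        using I assms False upd[of "row_entry M j m a b" "M ''H'' (Suc j)"]
        by (simp add: runs_def I_def store_apply)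
    qed
  qed
  then show ?thesis by (rule runs_mono) (auto simp: I_def)
qed

definition sum_row :: prog where
  "sum_row = For ''k'' (var ''z'')
     (Assign ''T'' (Add (var ''j'') (Const 1)) (Add (var ''k'') (Const 1))
       (Add (Cell ''T'' (Add (var ''j'') (Const 1)) (var ''k''))
            (Cell ''H'' (Add (var ''j'') (Const 1)) (Add (var ''k'') (Const 1)))))"

text \<open>
  The entry \<open>T (j + 1) 0\<close> is never assigned; it starts the sum because untouched cells are 0.
\<close>

lemma runs_sum_row:
  assumes "M ''j'' 0 0 = j" "M ''z'' 0 0 = z" and T: "M ''T'' (Suc j) = (\<lambda>_. 0)"
  shows "runs sum_row M (\<lambda>M'. (\<forall>x. x \<notin> {''k'', ''T''} \<longrightarrow> M' x = M x) \<and>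
      M' ''T'' = (M ''T'')(Suc j := (\<lambda>q. if q \<le> z then \<Sum>t = 1..q. M ''H'' (Suc j) t else 0)))
      (10 + z * 60)"
proof -
  define I where "I k M' \<longleftrightarrow> (\<forall>x. x \<notin> {''k'', ''T''} \<longrightarrow> M' x = M x) \<and>
      M' ''T'' = (M ''T'')(Suc j := (\<lambda>q. if q \<le> k then \<Sum>t = 1..q. M ''H'' (Suc j) t else 0))" for k M'
  have "runs sum_row M (I z) (1 + expr_steps (var ''z'') + z * (50 + 1))"
    unfolding sum_row_def
  proof (rule runs_For)
    show "eval_expr (var ''z'') M = z" by (simp add: assms)
    show "I 0 M" using T by (auto simp: I_def fun_eq_iff)
    fix k M' assume I: "I k M'"
    have upd: "(\<lambda>q. if q \<le> k then \<Sum>t = 1..q. f t else 0)(Suc k := (\<Sum>t = 1..k. f t) + f (Suc k))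
        = (\<lambda>q. if q \<le> Suc k then \<Sum>t = 1..q. f t else 0)" for f :: "nat \<Rightarrow> nat"
      by (auto simp: fun_eq_iff le_Suc_eq)
    show "runs (Assign ''T'' (Add (var ''j'') (Const 1)) (Add (var ''k'') (Const 1))
       (Add (Cell ''T'' (Add (var ''j'') (Const 1)) (var ''k''))
            (Cell ''H'' (Add (var ''j'') (Const 1)) (Add (var ''k'') (Const 1)))))
        (store ''k'' 0 0 k M') (I (Suc k)) 50"
      using I assms upd[of "M ''H'' (Suc j)"]
      by (simp add: runs_def I_def store_apply)
  qed
  then show ?thesis by (rule runs_mono) (auto simp: I_def)
qed

definition copy_row :: prog where
  "copy_row = For ''k'' (var ''n'')
     (Assign ''h'' (Add (var ''k'') (Const 1)) (Const 0) (Cell ''H'' (var ''s'') (Add (var ''k'') (Const 1))))"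

lemma runs_copy_row:
  assumes "M ''n'' 0 0 = n" "M ''s'' 0 0 = s"
  shows "runs copy_row M (\<lambda>M'. \<forall>k \<in> {1..n}. M' ''h'' k 0 = M ''H'' s k) (10 + n * 40)"
proof -
  define I where "I k M' \<longleftrightarrow> (\<forall>x. x \<notin> {''k'', ''h''} \<longrightarrow> M' x = M x) \<and>
      (\<forall>q \<in> {1..k}. M' ''h'' q 0 = M ''H'' s q)" for k M'
  have "runs copy_row M (I n) (1 + expr_steps (var ''n'') + n * (30 + 1))"
    unfolding copy_row_def
  proof (rule runs_For)
    show "eval_expr (var ''n'') M = n" by (simp add: assms)
    show "I 0 M" by (simp add: I_def)
    fix k M' assume I: "I k M'"
    show "runs (Assign ''h'' (Add (var ''k'') (Const 1)) (Const 0)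
        (Cell ''H'' (var ''s'') (Add (var ''k'') (Const 1)))) (store ''k'' 0 0 k M') (I (Suc k)) 30"
    proof -
      have old: "\<forall>q \<in> {1..k}. M' ''h'' q 0 = M ''H'' s q"
        and frame: "\<forall>x. x \<notin> {''k'', ''h''} \<longrightarrow> M' x = M x"
        using I assms by (simp_all add: I_def)
      have "q = Suc k \<or> q \<in> {1..k}" if "q \<in> {1..Suc k}" for q using that by auto
      with old have new: "\<forall>q \<in> {Suc 0..Suc k}. q \<noteq> Suc k \<longrightarrow> M' ''h'' q 0 = M ''H'' s q"
        by (metis One_nat_def)
      show ?thesis
        using frame new by (simp add: runs_def I_def store_apply assms(2))
    qed
  qed
  then show ?thesis by (rule runs_mono) (auto simp: I_def)
qed

definition init_row :: prog where
  "init_row = Seq (assign ''m'' (Cell ''r'' (var ''j'') (Const 0)))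
     (Seq (assign ''z'' (Cell ''r'' (Add (var ''j'') (Const 1)) (Const 0)))
       (assign ''a'' (Const 0)))"

definition count_minus :: prog where
  "count_minus = assign ''b'' (Sub (Sub (Sub (var ''z'') (var ''m'')) (Const 1)) (var ''a''))"

text \<open>
  The first assignment provides the total 1 of the empty poset as row 0 of the prefix sums.
\<close>

definition spectrum_prog :: prog where
  "spectrum_prog =
     Seq (Assign ''T'' (Const 0) (Const 0) (Const 1))
       (Seq (For ''j'' (var ''s'')
               (Seq init_row (Seq count_plus (Seq count_minus (Seq fill_row sum_row)))))
         copy_row)"

context record_set
begin

definition spectrum_row :: "nat \<Rightarrow> nat \<Rightarrow> nat" where
  "spectrum_row j k = (if 1 \<le> j \<and> 1 \<le> k \<and> k \<le> root_at R j then root_spectrum n \<epsilon> R j k else 0)"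

definition prefix_row :: "nat \<Rightarrow> nat \<Rightarrow> nat" where
  "prefix_row j d = (if j = 0 then if d = 0 then 1 else 0
     else if d \<le> root_at R j then \<Sum>t = 1..d. spectrum_row j t else 0)"

text \<open>
  Requiring the later rows to be still 0 supplies both the entries of a new row that the
  recursion leaves out and the start of its prefix sums.
\<close>

definition rows_done :: "nat \<Rightarrow> memory \<Rightarrow> bool" where
  "rows_done i M \<longleftrightarrow>
     (\<forall>x \<in> {''n'', ''eps'', ''s'', ''r'', ''fact'', ''binom''}. M x = input_memory n \<epsilon> R x) \<and>
     M ''H'' = (\<lambda>j. if j \<le> i then spectrum_row j else (\<lambda>_. 0)) \<and>
     M ''T'' = (\<lambda>j. if j \<le> i then prefix_row j else (\<lambda>_. 0))"

lemma prefix_row_spectrum: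
  assumes "1 \<le> j" "d \<le> root_at R j"
  shows "prefix_row j d = (\<Sum>t = 1..d. root_spectrum n \<epsilon> R j t)"
  using assms by (auto simp: prefix_row_def spectrum_row_def intro!: sum.cong)

lemma cut_count_prefix:
  assumes j: "1 \<le> j" "j \<le> card R" and d: "d \<le> root_at R (j - 1)"
  shows "cut_count j d = (if root_at R (j - 1) \<noteq> 0 \<and> \<epsilon> (root_at R (j - 1)) = Pos
    then prefix_row (j - 1) (root_at R (j - 1)) - prefix_row (j - 1) d else prefix_row (j - 1) d)"
proof (cases "j = 1")
  case True
  then show ?thesis using d by (simp add: cut_count_def prefix_row_def root_at_def)
next
  case False
  let ?m = "root_at R (j - 1)" and ?h = "root_spectrum n \<epsilon> R (j - 1)"
  have m: "?m \<noteq> 0" using root_at_less[of 0 "j - 1"] j False by (auto simp: root_at_def)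
  have "(\<Sum>t = 1..?m. ?h t) = (\<Sum>t = 1..d. ?h t) + (\<Sum>t = d + 1..?m. ?h t)"
  proof -
    have "{1..?m} = {1..d} \<union> {d + 1..?m}" using d by auto
    moreover have "{1..d} \<inter> {d + 1..?m} = {}" by auto
    ultimately show ?thesis by (metis sum.union_disjoint finite_atLeastAtMost)
  qed
  moreover have "prefix_row (j - 1) ?m = (\<Sum>t = 1..?m. ?h t)" "prefix_row (j - 1) d = (\<Sum>t = 1..d. ?h t)"
    using j False d by (intro prefix_row_spectrum; simp)+
  ultimately show ?thesis
    using m False by (cases "\<epsilon> ?m") (auto simp: cut_count_def C_sum_def)
qed

text \<open>
  All table look-ups stay within the precomputed range, since \<open>m + a + b + 1 = z \<le> n\<close>.
\<close>

lemma spectrum_row_entry: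
  assumes inv: "rows_done i M" and i: "i < card R"
  defines "m \<equiv> root_at R i" and "a \<equiv> a_count \<epsilon> R (Suc i)" and "b \<equiv> b_count \<epsilon> R (Suc i)"
  shows "spectrum_row (Suc i) = (\<lambda>k. if a < k \<and> k \<le> a + (m + 1) then row_entry M i m a b (k - a - 1) else 0)"
proof
  fix k
  let ?z = "root_at R (Suc i)"
  have sum: "m + a + b + 1 = ?z" using block_sizes[of "Suc i"] i by (simp add: m_def a_def b_def)
  have zn: "?z \<le> n" using root_at_mem[of "Suc i"] i R_subset by auto
  show "spectrum_row (Suc i) k
      = (if a < k \<and> k \<le> a + (m + 1) then row_entry M i m a b (k - a - 1) else 0)"
  proof (cases "a < k \<and> k \<le> a + (m + 1)")
    case True
    define d where "d = k - a - 1"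
    have d: "d \<le> m" "k = d + a + 1" using True by (auto simp: d_def)
    have eps: "1 \<le> M ''eps'' m 0 \<longleftrightarrow> m \<noteq> 0 \<and> \<epsilon> m = Pos"
      using inv sum zn by (auto simp: rows_done_def input_memory_def)
    have "a \<le> n" "b \<le> n" "d + a \<le> n" "m - d + b \<le> n" using sum zn d by auto
    then have tab: "M ''fact'' a 0 = fact a" "M ''fact'' b 0 = fact b"
        "M ''binom'' (d + a) a = ((d + a) choose a)" "M ''binom'' (m - d + b) b = ((m - d + b) choose b)"
      using inv by (simp_all add: rows_done_def input_memory_def)
    have pre: "M ''T'' i = prefix_row i" using inv by (simp add: rows_done_def)
    have "spectrum_row (Suc i) k = root_spectrum n \<epsilon> R (Suc i) (d + a + 1)"
      using d sum by (simp add: spectrum_row_def)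
    also have "\<dots> = fact a * fact b * ((d + a) choose a) * ((m - d + b) choose b) * cut_count (Suc i) d"
      using root_spectrum_step[of "Suc i" d] i d by (simp add: m_def a_def b_def)
    also have "cut_count (Suc i) d = (if 1 \<le> M ''eps'' m 0 then M ''T'' i m - M ''T'' i d else M ''T'' i d)"
      unfolding eps pre using cut_count_prefix[of "Suc i" d] i d by (simp add: m_def)
    also have "fact a * fact b * ((d + a) choose a) * ((m - d + b) choose b) * \<dots>
        = row_entry M i m a b (k - a - 1)"
      unfolding d_def[symmetric] row_entry_def tab by (rule refl)
    finally show ?thesis unfolding if_P[OF True] .
  next
    case False
    have "spectrum_row (Suc i) k = 0"
    proof (cases "k \<in> {1..?z}")
      case True
      then show ?thesis
        using root_spectrum_eq_0[of "Suc i" k] i False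
        by (auto simp: spectrum_row_def m_def a_def)
    qed (auto simp: spectrum_row_def)
    then show ?thesis unfolding if_not_P[OF False] .
  qed
qed

text \<open>
  The intermediate assertions \<open>Q1\<close> to \<open>Q4\<close> hold after the successive parts of the loop body. Each keeps
  a list of the arrays touched so far; the rest still agrees with the memory before the row.
\<close>

lemma runs_row:
  assumes inv: "rows_done i M" and i: "i < card R"
  shows "runs (Seq init_row (Seq count_plus (Seq count_minus (Seq fill_row sum_row))))
    (store ''j'' 0 0 i M) (rows_done (Suc i)) (600 * n)"
proof -
  define m z a b where "m = root_at R i" and "z = root_at R (Suc i)"
    and "a = a_count \<epsilon> R (Suc i)" and "b = b_count \<epsilon> R (Suc i)"
  have sum: "m + a + b + 1 = z" using block_sizes[of "Suc i"] i by (simp add: m_def z_def a_def b_def)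
  have zn: "z \<le> n" using root_at_mem[of "Suc i"] i R_subset by (auto simp: z_def)
  have M: "M ''r'' i 0 = m" "M ''r'' (Suc i) 0 = z" "M ''T'' (Suc i) = (\<lambda>_. 0)" "M ''H'' (Suc i) = (\<lambda>_. 0)"
    "\<And>p. 1 \<le> p \<Longrightarrow> p < n \<Longrightarrow> 1 \<le> M ''eps'' p 0 \<longleftrightarrow> \<epsilon> p = Pos"
    using inv i by (auto simp: rows_done_def input_memory_def m_def z_def root_at_def)
  have a: "card {p. m < p \<and> p \<le> m + (z - m - 1) \<and> 1 \<le> M ''eps'' p 0} = a"
  proof -
    have "{p. m < p \<and> p \<le> m + (z - m - 1) \<and> 1 \<le> M ''eps'' p 0} = {p. m < p \<and> p < z \<and> \<epsilon> p = Pos}"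
      using M(5) sum zn by auto
    then show ?thesis by (simp add: a_def sign_count_def m_def z_def)
  qed
  define Q1 where "Q1 M' \<longleftrightarrow> (\<forall>x. x \<notin> {''j'', ''m'', ''z'', ''a''} \<longrightarrow> M' x = M x) \<and>
      M' ''j'' 0 0 = i \<and> M' ''m'' 0 0 = m \<and> M' ''z'' 0 0 = z \<and> M' ''a'' 0 0 = 0" for M'
  define Q2 where "Q2 M' \<longleftrightarrow> (\<forall>x. x \<notin> {''j'', ''m'', ''z'', ''a'', ''i''} \<longrightarrow> M' x = M x) \<and>
      M' ''j'' 0 0 = i \<and> M' ''m'' 0 0 = m \<and> M' ''z'' 0 0 = z \<and> M' ''a'' 0 0 = a" for M'
  define Q3 where "Q3 M' \<longleftrightarrow> (\<forall>x. x \<notin> {''j'', ''m'', ''z'', ''a'', ''i'', ''b''} \<longrightarrow> M' x = M x) \<and>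
      M' ''j'' 0 0 = i \<and> M' ''m'' 0 0 = m \<and> M' ''z'' 0 0 = z \<and> M' ''a'' 0 0 = a \<and> M' ''b'' 0 0 = b" for M'
  define Q4 where "Q4 M' \<longleftrightarrow>
      (\<forall>x. x \<notin> {''j'', ''m'', ''z'', ''a'', ''i'', ''b'', ''d'', ''c'', ''H''} \<longrightarrow> M' x = M x) \<and>
      M' ''j'' 0 0 = i \<and> M' ''z'' 0 0 = z \<and> M' ''H'' = (M ''H'')(Suc i := spectrum_row (Suc i))" for M'
  have 1: "runs init_row (store ''j'' 0 0 i M) Q1 40"
    by (simp add: init_row_def runs_def Q1_def store_apply M)
  have 2: "runs count_plus M' Q2 (20 + (z - m - 1) * 30)" if "Q1 M'" for M'
  proof -
    have eps: "M' ''eps'' = M ''eps''" using that by (simp add: Q1_def)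
    have q: "M' ''m'' 0 0 = m" "M' ''z'' 0 0 = z" "M' ''a'' 0 0 = 0" using that by (auto simp: Q1_def)
    show ?thesis
      using runs_count_plus[of M' m z, OF q] that unfolding eps a
      by (elim runs_mono) (simp_all add: Q1_def Q2_def)
  qed
  have 3: "runs count_minus M' Q3 20" if "Q2 M'" for M'
  proof -
    have "z - m - 1 - a = b" using sum by simp
    then show ?thesis using that by (simp add: count_minus_def runs_def Q2_def Q3_def store_apply)
  qed
  have 4: "runs fill_row M' Q4 (10 + (m + 1) * 200)" if "Q3 M'" for M'
  proof -
    have q: "M' ''j'' 0 0 = i" "M' ''m'' 0 0 = m" "M' ''a'' 0 0 = a" "M' ''b'' 0 0 = b"
      using that by (auto simp: Q3_def)
    have e: "row_entry M' i m a b = row_entry M i m a b" "M' ''H'' = M ''H''"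
      using that by (auto simp: row_entry_def Q3_def fun_eq_iff)
    have row: "(\<lambda>k. if a < k \<and> k \<le> a + (m + 1) then row_entry M i m a b (k - a - 1) else M ''H'' (Suc i) k)
        = spectrum_row (Suc i)"
      unfolding M(4) using spectrum_row_entry[OF inv i, folded m_def a_def b_def] by (rule sym)
    show ?thesis
      using runs_fill_row[of M' i m a b, OF q] that unfolding e row
      by (elim runs_mono) (simp_all add: Q3_def Q4_def)
  qed
  have 5: "runs sum_row M' (rows_done (Suc i)) (10 + z * 60)" if "Q4 M'" for M'
  proof -
    have q: "M' ''j'' 0 0 = i" "M' ''z'' 0 0 = z" "M' ''T'' (Suc i) = (\<lambda>_. 0)"
      using that M(3) by (auto simp: Q4_def)
    have H: "M' ''H'' (Suc i) = spectrum_row (Suc i)" using that by (simp add: Q4_def)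
    have row: "(\<lambda>q. if q \<le> z then \<Sum>t = 1..q. spectrum_row (Suc i) t else 0) = prefix_row (Suc i)"
      by (simp add: prefix_row_def z_def fun_eq_iff)
    have le: "(\<lambda>j. if j \<le> i then f j else (\<lambda>_. 0))(Suc i := f (Suc i)) = (\<lambda>j. if j \<le> Suc i then f j else (\<lambda>_. 0))"
      for f :: "nat \<Rightarrow> nat \<Rightarrow> nat"
      by (auto simp: fun_eq_iff le_Suc_eq)
    show ?thesis
      using runs_sum_row[of M' i z, OF q] unfolding H row
      by (rule runs_mono) (use that inv le[of spectrum_row] le[of prefix_row] in \<open>auto simp: Q4_def rows_done_def\<close>)
  qed
  have "runs (Seq init_row (Seq count_plus (Seq count_minus (Seq fill_row sum_row))))
    (store ''j'' 0 0 i M) (rows_done (Suc i))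
    (40 + (20 + (z - m - 1) * 30 + (20 + (10 + (m + 1) * 200 + (10 + z * 60)))))"
    by (intro runs_Seq[OF 1] runs_Seq[OF 2] runs_Seq[OF 3] runs_Seq[OF 4] 5)
  then show ?thesis
    by (rule runs_mono) (use sum zn n_pos in auto)
qed

lemma runs_spectrum_prog:
  "runs spectrum_prog (input_memory n \<epsilon> R)
     (\<lambda>M. \<forall>k \<in> {1..n}. M ''h'' k 0 = root_spectrum n \<epsilon> R (card R) k) (1000 * n ^ 2)"
proof -
  have s: "card R \<le> n" using card_mono[OF _ R_subset] by simp
  have 1: "runs (Assign ''T'' (Const 0) (Const 0) (Const 1)) (input_memory n \<epsilon> R) (rows_done 0) 4"
    by (auto simp: runs_def rows_done_def store_apply input_memory_def fun_eq_iff
        spectrum_row_def prefix_row_def)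
  have 2: "runs (For ''j'' (var ''s'')
               (Seq init_row (Seq count_plus (Seq count_minus (Seq fill_row sum_row))))) M
      (rows_done (card R)) (1 + expr_steps (var ''s'') + card R * (600 * n + 1))" if "rows_done 0 M" for M
  proof (rule runs_For)
    show "eval_expr (var ''s'') M = card R" using that by (simp add: rows_done_def input_memory_def)
  qed (use that runs_row in blast)+
  have 3: "runs copy_row M (\<lambda>M. \<forall>k \<in> {1..n}. M ''h'' k 0 = root_spectrum n \<epsilon> R (card R) k) (10 + n * 40)"
    if "rows_done (card R) M" for M
  proof -
    have "M ''n'' 0 0 = n" "M ''s'' 0 0 = card R" "M ''H'' (card R) = spectrum_row (card R)"
      using that by (auto simp: rows_done_def input_memory_def)
    then show ?thesis
      using card_R_pos root_at_card
      by (intro runs_mono[OF runs_copy_row[of M n "card R"]]) (auto simp: spectrum_row_def)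
  qed
  have "runs spectrum_prog (input_memory n \<epsilon> R)
      (\<lambda>M. \<forall>k \<in> {1..n}. M ''h'' k 0 = root_spectrum n \<epsilon> R (card R) k)
      (4 + (1 + expr_steps (var ''s'') + card R * (600 * n + 1) + (10 + n * 40)))"
    unfolding spectrum_prog_def by (intro runs_Seq[OF 1] runs_Seq[OF 2] 3)
  moreover have "4 + (1 + expr_steps (var ''s'') + card R * (600 * n + 1) + (10 + n * 40)) \<le> 1000 * n ^ 2"
  proof -
    have "card R * (600 * n + 1) \<le> n * (600 * n + 1)" using s by (rule mult_right_mono) simp
    also have "\<dots> = 600 * (n * n) + n" by (simp add: algebra_simps)
    finally have "card R * (600 * n + 1) \<le> 600 * (n * n) + n" .
    moreover have "1 \<le> n * n" "n \<le> n * n" using n_pos by auto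
    ultimately show ?thesis unfolding power2_eq_square expr_steps.simps by linarith
  qed
  ultimately show ?thesis by (auto simp: runs_def)
qed

end

section \<open>The recursion, the record count and the running time\<close>

theorem proposition8p2:
  shows
    "(\<forall>(n::nat) (\<epsilon> :: nat \<Rightarrow> sign) (R :: nat set).
        n \<ge> 1 \<and> R \<subseteq> {1..n} \<and> n \<in> R \<longrightarrow>
        (let s = card R;
             r = root_at R;
             a = a_count \<epsilon> R;
             b = b_count \<epsilon> R;
             h = root_spectrum n \<epsilon> R;
             C = C_sum n \<epsilon> R
         in
           (\<forall>k\<in>{1..r 1}. h 1 k = (if k = a 1 + 1 then fact (a 1) * fact (b 1) else 0)) \<and>
           (\<forall>j\<in>{2..s}.
              (\<forall>d\<in>{0..r (j - 1)}.
                 h j (d + a j + 1) =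
                   fact (a j) * fact (b j) * ((d + a j) choose (a j))
                     * ((r (j - 1) - d + b j) choose (b j)) * C j d) \<and>
              (\<forall>k\<in>{1..r j} - {d + a j + 1 |d. d \<in> {0..r (j - 1)}}. h j k = 0)) \<and>
           (\<forall>k\<in>{1..n}. ell n \<epsilon> R k = h s k) \<and>
           card {\<pi>. \<pi> permutes {1..n} \<and> Rec n \<epsilon> \<pi> = R} = (\<Sum>k = 1..n. h s k)))
     \<and>
     (\<exists>(P :: prog) (K :: nat).
        \<forall>(n::nat) (\<epsilon> :: nat \<Rightarrow> sign) (R :: nat set).
          n \<ge> 1 \<and> R \<subseteq> {1..n} \<and> n \<in> R \<longrightarrow>
          (let (M, t) = run P (input_memory n \<epsilon> R)
           in (\<forall>k\<in>{1..n}. M ''h'' k 0 = root_spectrum n \<epsilon> R (card R) k) \<and> t \<le> K * n ^ 2))"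
proof (intro conjI allI impI exI[of _ spectrum_prog] exI[of _ 1000])
  fix n :: nat and \<epsilon> :: "nat \<Rightarrow> sign" and R :: "nat set"
  assume asm: "n \<ge> 1 \<and> R \<subseteq> {1..n} \<and> n \<in> R"
  interpret record_set n \<epsilon> R using asm by unfold_locales auto
  let ?h = "root_spectrum n \<epsilon> R"
  \<comment> \<open>The first gap starts at 0, so only \<open>d = 0\<close> occurs and the binomials are 1.\<close>
  have first: "?h 1 k = (if k = a_count \<epsilon> R 1 + 1 then fact (a_count \<epsilon> R 1) * fact (b_count \<epsilon> R 1) else 0)"
    if "k \<in> {1..root_at R 1}" for k
    using that root_spectrum_step[of 1 0] root_spectrum_eq_0[of 1 k] card_R_pos
    by (auto simp: root_at_def[of R 0] cut_count_def)
  have last: "?h (card R) k = spectrum n k" for k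
    using root_spectrum_eq[of "card R"] card_R_pos root_at_card by simp
  have step: "?h j (d + a_count \<epsilon> R j + 1) =
      fact (a_count \<epsilon> R j) * fact (b_count \<epsilon> R j) * ((d + a_count \<epsilon> R j) choose (a_count \<epsilon> R j))
        * ((root_at R (j - 1) - d + b_count \<epsilon> R j) choose (b_count \<epsilon> R j)) * C_sum n \<epsilon> R j d"
    if "j \<in> {2..card R}" "d \<in> {0..root_at R (j - 1)}" for j d
    using root_spectrum_step[of j d] that by (simp add: cut_count_def)
  have zero: "?h j k = 0"
    if "j \<in> {2..card R}" "k \<in> {1..root_at R j} - {d + a_count \<epsilon> R j + 1 |d. d \<in> {0..root_at R (j - 1)}}" for j k
    using that by (intro root_spectrum_eq_0) auto
  show "let s = card R; r = root_at R; a = a_count \<epsilon> R; b = b_count \<epsilon> R; h = ?h; C = C_sum n \<epsilon> R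
    in (\<forall>k\<in>{1..r 1}. h 1 k = (if k = a 1 + 1 then fact (a 1) * fact (b 1) else 0)) \<and>
       (\<forall>j\<in>{2..s}.
          (\<forall>d\<in>{0..r (j - 1)}.
             h j (d + a j + 1) =
               fact (a j) * fact (b j) * ((d + a j) choose (a j))
                 * ((r (j - 1) - d + b j) choose (b j)) * C j d) \<and>
          (\<forall>k\<in>{1..r j} - {d + a j + 1 |d. d \<in> {0..r (j - 1)}}. h j k = 0)) \<and>
       (\<forall>k\<in>{1..n}. ell n \<epsilon> R k = h s k) \<and>
       card {\<pi>. \<pi> permutes {1..n} \<and> Rec n \<epsilon> \<pi> = R} = (\<Sum>k = 1..n. h s k)"
    unfolding Let_def last card_Rec_eq ell_eq
    by (intro conjI ballI refl first step zero)
next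
  fix n :: nat and \<epsilon> :: "nat \<Rightarrow> sign" and R :: "nat set"
  assume asm: "n \<ge> 1 \<and> R \<subseteq> {1..n} \<and> n \<in> R"
  interpret record_set n \<epsilon> R using asm by unfold_locales auto
  show "let (M, t) = run spectrum_prog (input_memory n \<epsilon> R)
    in (\<forall>k\<in>{1..n}. M ''h'' k 0 = root_spectrum n \<epsilon> R (card R) k) \<and> t \<le> 1000 * n ^ 2"
    using runs_spectrum_prog by (simp add: runs_def case_prod_beta Let_def)
qed

end
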